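(* Let the oracle used be an $r$-approximation, $r\ge1$. By using threshold payments, Deterministic-Large$\left(\frac{r}{r+1},\frac1r,A,B\right)$ is truthful and budget feasible, and under the large market assumption it is a $1+r$ approximation of the optimum (in the large market limit). By using the greedy algorithm of Sviridenko as the oracle, with $r=\frac{e}{e-1}$, one gets a mechanism with approximation guarantee $1+\frac{e}{e-1}\approx 2.58$.
   Context: Setting. A buyer with budget $B>0$ faces a finite set $A$ of $n$ sellers. Seller $i$ owns one item (also called $i$) and has a private cost $c_i\ge 0$; his utility when selling at payment $p_i$ is $p_i-c_i$. The buyer's value $v:2^A\to\mathbb{R}_{\ge 0}$ is monotone non-decreasing and submodular, with $v(\{i\})>0$ for all $i$. Write $v(i)=v(\{i\})$, $m_i(S)=v(S\cup\{i\})-v(S)$, $c(S)=\sum_{i\in S}c_i$, and $opt(A',B)=\max\{v(S):S\subseteq A',\ c(S)\le B\}$ for $A'\subseteq A$. Mechanisms. A deterministic allocation rule $f$ maps each declared cost vector $c$ to a winning set $f(c)\subseteq A$. Threshold payments: a winner $i$ is paid $p_i=\inf\{b: i\notin f(b,c_{-i})\}$, losers are paid $0$. The mechanism is truthful if declaring the true cost is always a dominant strategy for each seller, and budget feasible if for every cost vector the total payment is at most $B$. Oracle. $Oracle(A',B)$ is a deterministic real-valued function of $A'\subseteq A$, $B$, $v$ and the declared costs of the sellers in $A'$ only, with $Oracle(A',B)\le opt(A',B)$; it is an $r$-approximation if also $r\cdot Oracle(A',B)\ge opt(A',B)$ always. Sviridenko's greedy algorithm for maximizing a monotone submodular function under a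 knapsack constraint is a (known) $\frac{e}{e-1}$-approximation oracle. Greedy order. $S_0=\emptyset$ and $S_i=S_{i-1}\cup\{\arg\max_{j\in A\setminus S_{i-1}} m_j(S_{i-1})/c_j\}$, ties broken by a fixed order on sellers; the ratio is $0$ if $m_j(S_{i-1})=0$ and $+\infty$ if $c_j=0<m_j(S_{i-1})$. Items are renamed so that $S_i\setminus S_{i-1}=\{i\}$. Greedy-TM$(\gamma,A,B)$: start with $k=1$; while $k\le |A|$ and $\frac{c_k}{m_k(S_{k-1})}\le\gamma\frac{B}{v(S_k)}$ increase $k$ by one (the condition is considered false if $m_k(S_{k-1})=0$); return $S_{k-1}$. Greedy-OM$(\alpha,A,B)$: start with $S=\emptyset$; for $i=1,\dots,|A|$, add $i$ to $S$ if $v(S_i)\le\alpha\, Oracle(A\setminus\{i\},B)$; return $S$. Deterministic-Large$(\alpha,\gamma,A,B)$: replace $A$ by $\{i\in A:c_i\le B\}$; return the intersection of the sets returned by Greedy-OM$(\alpha,A,B)$ and Greedy-TM$(\gamma,A,B)$. Large market assumption. Let $\theta=\max_{i\in A}v(i)/opt(A,B)$ (with $opt(A,B)>0$). A $\rho$ approximation in the large market limit means: for every $\varepsilon>0$ there is $\theta_0>0$ such that on every instance with $\theta\le\theta_0$ the winning set $S$ satisfies $(\rho+\varepsilon)v(S)\ge opt(A,B)$. *)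

theory Defs
  imports Complex_Main "HOL-Library.Extended_Real" "HOL-Library.While_Combinator"
begin

section \<open>Procurement markets\<close>

type_synonym 'a valuation = "'a set \<Rightarrow> real"
type_synonym 'a costs = "'a \<Rightarrow> real"

(* Valuations and cost vectors are total HOL functions; only their restrictions to Pow A
   and to A are constrained. The value of the empty set is not assumed to be 0. *)

definition submodular_on :: "'a set \<Rightarrow> 'a valuation \<Rightarrow> bool" where
  "submodular_on A v \<longleftrightarrow> (\<forall>S T. S \<subseteq> A \<longrightarrow> T \<subseteq> A \<longrightarrow> v (S \<union> T) + v (S \<inter> T) \<le> v S + v T)"

definition valuation_on :: "'a set \<Rightarrow> 'a valuation \<Rightarrow> bool" where
  "valuation_on A v \<longleftrightarrow>
     (\<forall>S\<subseteq>A. 0 \<le> v S) \<and>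
     (\<forall>S T. S \<subseteq> T \<longrightarrow> T \<subseteq> A \<longrightarrow> v S \<le> v T) \<and>
     submodular_on A v \<and>
     (\<forall>i\<in>A. 0 < v {i})"

definition market :: "'a set \<Rightarrow> 'a valuation \<Rightarrow> real \<Rightarrow> bool" where
  "market A v B \<longleftrightarrow> finite A \<and> valuation_on A v \<and> 0 < B"

definition cost_vector :: "'a set \<Rightarrow> 'a costs \<Rightarrow> bool" where
  "cost_vector A c \<longleftrightarrow> (\<forall>i\<in>A. 0 \<le> c i)"

definition marginal :: "'a valuation \<Rightarrow> 'a \<Rightarrow> 'a set \<Rightarrow> real" where
  "marginal v i S = v (insert i S) - v S"

definition opt :: "'a valuation \<Rightarrow> 'a costs \<Rightarrow> 'a set \<Rightarrow> real \<Rightarrow> real" where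
  "opt v c A B = Max {v S |S. S \<subseteq> A \<and> sum c S \<le> B}"

section \<open>Mechanisms\<close>

type_synonym 'a allocation = "'a costs \<Rightarrow> 'a set"

(* Declared costs are nonnegative, hence the infimum over nonnegative bids. On reals,
   Inf {} is unspecified (rather than infinite); this is harmless for the mechanism
   considered here, under which a seller bidding more than the budget never wins. *)
definition threshold_payment :: "'a allocation \<Rightarrow> 'a costs \<Rightarrow> 'a \<Rightarrow> real" where
  "threshold_payment f c i = (if i \<in> f c then Inf {b. 0 \<le> b \<and> i \<notin> f (c(i := b))} else 0)"

(* utility of seller i with true cost t when the declared costs are d *)
definition utility :: "'a allocation \<Rightarrow> 'a \<Rightarrow> real \<Rightarrow> 'a costs \<Rightarrow> real" where
  "utility f i t d = (if i \<in> f d then threshold_payment f d i - t else 0)"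

definition truthful :: "'a set \<Rightarrow> 'a allocation \<Rightarrow> bool" where
  "truthful A f \<longleftrightarrow>
     (\<forall>i\<in>A. \<forall>t\<ge>0. \<forall>d. cost_vector A d \<longrightarrow> utility f i t d \<le> utility f i t (d(i := t)))"

definition budget_feasible :: "'a set \<Rightarrow> real \<Rightarrow> 'a allocation \<Rightarrow> bool" where
  "budget_feasible A B f \<longleftrightarrow>
     (\<forall>c. cost_vector A c \<longrightarrow> (\<Sum>i\<in>A. threshold_payment f c i) \<le> B)"

(* For A = {} the maximum is unspecified; no claim depends on its value. *)
definition market_theta :: "'a set \<Rightarrow> 'a valuation \<Rightarrow> real \<Rightarrow> 'a costs \<Rightarrow> real" where
  "market_theta A v B c = Max ((\<lambda>i. v {i}) ` A) / opt v c A B"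

(* M A v B is the allocation rule used in the market with sellers A, valuation v, budget B. *)
definition large_market_approximation ::
    "real \<Rightarrow> ('a set \<Rightarrow> 'a valuation \<Rightarrow> real \<Rightarrow> 'a allocation) \<Rightarrow> bool" where
  "large_market_approximation \<rho> M \<longleftrightarrow>
     (\<forall>\<epsilon>>0. \<exists>\<theta>\<^sub>0>0. \<forall>A v B c.
        market A v B \<longrightarrow> cost_vector A c \<longrightarrow> 0 < opt v c A B \<longrightarrow> market_theta A v B c \<le> \<theta>\<^sub>0 \<longrightarrow>
        opt v c A B \<le> (\<rho> + \<epsilon>) * v (M A v B c))"

section \<open>Oracles\<close>

(* declared costs, set of available sellers, budget *)
type_synonym 'a value_oracle = "'a costs \<Rightarrow> 'a set \<Rightarrow> real \<Rightarrow> real"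

definition approximation_oracle :: "real \<Rightarrow> 'a set \<Rightarrow> 'a valuation \<Rightarrow> 'a value_oracle \<Rightarrow> bool" where
  "approximation_oracle r A v Orc \<longleftrightarrow>
     (\<forall>A' B c. A' \<subseteq> A \<longrightarrow> 0 < B \<longrightarrow> cost_vector A c \<longrightarrow>
        (\<forall>c'. cost_vector A c' \<longrightarrow> (\<forall>i\<in>A'. c' i = c i) \<longrightarrow> Orc c' A' B = Orc c A' B) \<and>
        Orc c A' B \<le> opt v c A' B \<and>
        opt v c A' B \<le> r * Orc c A' B)"

section \<open>Greedy order\<close>

definition ratio :: "'a valuation \<Rightarrow> 'a costs \<Rightarrow> 'a set \<Rightarrow> 'a \<Rightarrow> ereal" where
  "ratio v c S j =
     (if marginal v j S = 0 then 0
      else if c j = 0 then \<infinity>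
      else ereal (marginal v j S / c j))"

(* The fixed tie-breaking order is the linear order of the seller type. *)
definition greedy_pick :: "'a::linorder valuation \<Rightarrow> 'a costs \<Rightarrow> 'a set \<Rightarrow> 'a set \<Rightarrow> 'a" where
  "greedy_pick v c S R = Min {j \<in> R. \<forall>k\<in>R. ratio v c S k \<le> ratio v c S j}"

primrec greedy_set :: "'a::linorder valuation \<Rightarrow> 'a costs \<Rightarrow> 'a set \<Rightarrow> nat \<Rightarrow> 'a set" where
  "greedy_set v c A 0 = {}"
| "greedy_set v c A (Suc k) =
     insert (greedy_pick v c (greedy_set v c A k) (A - greedy_set v c A k)) (greedy_set v c A k)"

(* the k-th item of the greedy order, 1 <= k <= card A *)
definition greedy_item :: "'a::linorder valuation \<Rightarrow> 'a costs \<Rightarrow> 'a set \<Rightarrow> nat \<Rightarrow> 'a" where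
  "greedy_item v c A k = greedy_pick v c (greedy_set v c A (k - 1)) (A - greedy_set v c A (k - 1))"

section \<open>The mechanism\<close>

definition TM_condition ::
    "real \<Rightarrow> 'a::linorder valuation \<Rightarrow> 'a costs \<Rightarrow> 'a set \<Rightarrow> real \<Rightarrow> nat \<Rightarrow> bool" where
  "TM_condition \<gamma> v c A B k \<longleftrightarrow>
     (let i = greedy_item v c A k; m = marginal v i (greedy_set v c A (k - 1))
      in m \<noteq> 0 \<and> c i / m \<le> \<gamma> * (B / v (greedy_set v c A k)))"

definition greedy_TM ::
    "real \<Rightarrow> 'a::linorder valuation \<Rightarrow> 'a costs \<Rightarrow> 'a set \<Rightarrow> real \<Rightarrow> 'a set" where
  "greedy_TM \<gamma> v c A B =
     greedy_set v c A (while (\<lambda>k. k \<le> card A \<and> TM_condition \<gamma> v c A B k) Suc 1 - 1)"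

definition greedy_OM ::
    "'a::linorder value_oracle \<Rightarrow> real \<Rightarrow> 'a valuation \<Rightarrow> 'a costs \<Rightarrow> 'a set \<Rightarrow> real \<Rightarrow> 'a set" where
  "greedy_OM Orc \<alpha> v c A B =
     {greedy_item v c A k |k. k \<in> {1..card A} \<and>
        v (greedy_set v c A k) \<le> \<alpha> * Orc c (A - {greedy_item v c A k}) B}"

definition deterministic_large ::
    "'a::linorder value_oracle \<Rightarrow> real \<Rightarrow> real \<Rightarrow> 'a set \<Rightarrow> 'a valuation \<Rightarrow> real \<Rightarrow> 'a allocation" where
  "deterministic_large Orc \<alpha> \<gamma> A v B c =
     (let A' = {i \<in> A. c i \<le> B} in greedy_OM Orc \<alpha> v c A' B \<inter> greedy_TM \<gamma> v c A' B)"

section \<open>Sviridenko's greedy algorithm\<close>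

(* State (S, R): current solution S and items R not yet considered. The item of R with the
   best ratio is added if it fits into the budget, and is discarded otherwise. *)
definition sviridenko_step ::
    "'a::linorder valuation \<Rightarrow> 'a costs \<Rightarrow> real \<Rightarrow> 'a set \<times> 'a set \<Rightarrow> 'a set \<times> 'a set" where
  "sviridenko_step v c B = (\<lambda>(S, R).
     let j = greedy_pick v c S R
     in (if sum c S + c j \<le> B then insert j S else S, R - {j}))"

definition sviridenko_extend ::
    "'a::linorder valuation \<Rightarrow> 'a costs \<Rightarrow> 'a set \<Rightarrow> real \<Rightarrow> 'a set \<Rightarrow> 'a set" where
  "sviridenko_extend v c A B U = fst ((sviridenko_step v c B ^^ card (A - U)) (U, A - U))"

(* Value of the best set among all feasible sets of at most two items and the greedy
   extensions of all feasible sets of three items. *)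
definition sviridenko :: "'a::linorder valuation \<Rightarrow> 'a value_oracle" where
  "sviridenko v c A B = Max (v `
     ({U. U \<subseteq> A \<and> card U \<le> 2 \<and> sum c U \<le> B} \<union>
      sviridenko_extend v c A B ` {U. U \<subseteq> A \<and> card U = 3 \<and> sum c U \<le> B}))"

end

theory Submission
  imports Defs
begin

text \<open>
  Lowering a bid only moves a seller forward in the greedy order, so the allocation rule is monotone
  and threshold payments make it truthful.

  Let \<open>S\<close> be the greedy prefix ending in the last winner. The oracle test gives
  \<open>opt \<ge> (1 + 1/r) v S\<close>. If seller \<open>i\<close> still wins with a bid \<open>b\<close>, chosen with marginal value \<open>m\<close>
  on top of the prefix \<open>T\<close>, then the greedy order gives \<open>opt - v (T \<union> {i}) \<le> B m / b\<close> and the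
  stopping rule gives \<open>r v (T \<union> {i}) \<le> B m / b\<close>. Whichever of \<open>v (T \<union> {i})\<close> and \<open>v S / r\<close> is
  larger, \<open>b \<le> B m / v S\<close>, and these bounds telescope to at most \<open>B\<close>.

  In a large market the stopping rule fires only at value about \<open>opt / (1 + r)\<close>, and the oracle test
  accepts every prefix of value up to about \<open>opt / (1 + r)\<close>.
\<close>

section \<open>Submodular valuations\<close>

lemma valuation_on_subset: "valuation_on A v \<Longrightarrow> A' \<subseteq> A \<Longrightarrow> valuation_on A' v"
  unfolding valuation_on_def submodular_on_def by (meson subset_trans subsetD)

lemma valuation_mono: "valuation_on A v \<Longrightarrow> S \<subseteq> T \<Longrightarrow> T \<subseteq> A \<Longrightarrow> v S \<le> v T"
  unfolding valuation_on_def by blast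

lemma valuation_nonneg: "valuation_on A v \<Longrightarrow> S \<subseteq> A \<Longrightarrow> 0 \<le> v S"
  unfolding valuation_on_def by blast

lemma valuation_pos:
  assumes "valuation_on A v" "S \<subseteq> A" "i \<in> S"
  shows "0 < v S"
proof -
  have "0 < v {i}" using assms unfolding valuation_on_def by blast
  also have "\<dots> \<le> v S" using assms by (intro valuation_mono) auto
  finally show ?thesis .
qed

lemma marginal_nonneg: "valuation_on A v \<Longrightarrow> S \<subseteq> A \<Longrightarrow> i \<in> A \<Longrightarrow> 0 \<le> marginal v i S"
  unfolding marginal_def using valuation_mono[of A v S "insert i S"] by auto

text \<open>For \<open>i\<close> outside \<open>T\<close> this is submodularity applied to
  \<open>insert i S\<close> and \<open>T\<close>, which intersect in \<open>S\<close>. For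
  \<open>i\<close> in \<open>T\<close> the left side is 0.\<close>

lemma marginal_antimono:
  assumes "valuation_on A v" "S \<subseteq> T" "T \<subseteq> A" "i \<in> A"
  shows "marginal v i T \<le> marginal v i S"
proof (cases "i \<in> T")
  case True
  then show ?thesis
    using marginal_nonneg[of A v S i] assms by (auto simp: marginal_def insert_absorb)
next
  case False
  have "insert i S \<union> T = insert i T" "insert i S \<inter> T = S" using False assms by auto
  moreover have "v (insert i S \<union> T) + v (insert i S \<inter> T) \<le> v (insert i S) + v T"
    using assms unfolding valuation_on_def submodular_on_def by (meson insert_subset subset_trans)
  ultimately show ?thesis by (simp add: marginal_def)
qed

text \<open>The value of the empty set may be positive; that it is nonnegative makes the marginal
  value over \<open>{}\<close> at most \<open>v {i}\<close>.\<close>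

lemma marginal_le_singleton:
  assumes "valuation_on A v" "S \<subseteq> A" "i \<in> A"
  shows "marginal v i S \<le> v {i}"
  using marginal_antimono[of A v "{}" S i] valuation_nonneg[of A v "{}"] assms
  by (simp add: marginal_def)

text \<open>The elements of \<open>X\<close> join one at a time; by diminishing returns each adds at
  most its marginal value on top of \<open>S\<close>.\<close>

lemma value_union_le_sum_marginals:
  assumes "valuation_on A v" "finite X" "X \<subseteq> A" "S \<subseteq> A"
  shows "v (S \<union> X) \<le> v S + (\<Sum>x\<in>X. marginal v x S)"
  using assms(2,3)
proof (induction X)
  case empty
  then show ?case by simp
next
  case (insert x X)
  have "marginal v x (S \<union> X) \<le> marginal v x S"
    using insert assms by (intro marginal_antimono[of A]) auto
  then show ?case using insert by (simp add: marginal_def)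
qed

section \<open>The optimum under changes of the seller set\<close>

lemma sum_cost_mono:
  fixes c :: "'a costs"
  assumes "cost_vector A c" "finite T" "S \<subseteq> T" "T \<subseteq> A"
  shows "sum c S \<le> sum c T"
  using assms by (intro sum_mono2) (auto simp: cost_vector_def)

lemma cost_vector_subset: "cost_vector A c \<Longrightarrow> A' \<subseteq> A \<Longrightarrow> cost_vector A' c"
  unfolding cost_vector_def by blast

text \<open>A positive budget makes the empty set feasible, so the maximum ranges over a finite
  nonempty family.\<close>

lemma opt_attained:
  assumes "finite A" "0 < B"
  obtains X where "X \<subseteq> A" "sum c X \<le> B" "opt v c A B = v X"
proof -
  let ?F = "{v S |S. S \<subseteq> A \<and> sum c S \<le> B}"
  have "finite ?F" using assms by auto
  moreover have "v {} \<in> ?F" using assms by fastforce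
  ultimately have "Max ?F \<in> ?F" by (intro Max_in) auto
  then show ?thesis using that unfolding opt_def by blast
qed

lemma opt_upper:
  assumes "finite A" "S \<subseteq> A" "sum c S \<le> B"
  shows "v S \<le> opt v c A B"
  unfolding opt_def by (rule Max_ge) (use assms in auto)

lemma opt_mono:
  assumes "finite A" "0 < B" "A' \<subseteq> A"
  shows "opt v c A' B \<le> opt v c A B"
proof -
  obtain X where "X \<subseteq> A'" "sum c X \<le> B" "opt v c A' B = v X"
    using assms by (metis finite_subset opt_attained)
  then show ?thesis using opt_upper[of A X c B v] assms by auto
qed

text \<open>With nonnegative costs, every member of a feasible set costs at most \<open>B\<close>.
  So the mechanism's first step, dropping the other sellers, is harmless.\<close>

lemma opt_affordable:
  assumes "finite A" "0 < B" "cost_vector A c"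
  shows "opt v c {i \<in> A. c i \<le> B} B = opt v c A B"
proof (rule antisym)
  show "opt v c {i \<in> A. c i \<le> B} B \<le> opt v c A B" using assms by (intro opt_mono) auto
  obtain X where X: "X \<subseteq> A" "sum c X \<le> B" "opt v c A B = v X"
    using assms by (metis opt_attained)
  have "c i \<le> B" if "i \<in> X" for i
    using sum_cost_mono[of A c X "{i}"] that X assms finite_subset by fastforce
  then show "opt v c A B \<le> opt v c {i \<in> A. c i \<le> B} B"
    using X assms by (auto intro: opt_upper)
qed

text \<open>An optimal set without \<open>i\<close> stays feasible and loses at most
  \<open>v {i}\<close>. In large markets this makes the loss from calling the oracle without seller
  \<open>i\<close> small.\<close>

lemma opt_le_opt_delete:
  assumes "finite A" "0 < B" "cost_vector A c" "valuation_on A v" "i \<in> A"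
  shows "opt v c A B \<le> opt v c (A - {i}) B + v {i}"
proof -
  obtain X where X: "X \<subseteq> A" "sum c X \<le> B" "opt v c A B = v X"
    using assms by (metis opt_attained)
  have "sum c (X - {i}) \<le> B"
    using sum_cost_mono[of A c X "X - {i}"] X assms finite_subset by fastforce
  then have "v (X - {i}) \<le> opt v c (A - {i}) B" using X assms by (intro opt_upper) auto
  moreover have "v X \<le> v (X - {i}) + v {i}"
  proof -
    have "v X \<le> v (insert i (X - {i}))" using X assms by (intro valuation_mono[of A]) auto
    moreover have "marginal v i (X - {i}) \<le> v {i}"
      using X assms by (intro marginal_le_singleton[of A]) auto
    ultimately show ?thesis by (simp add: marginal_def)
  qed
  ultimately show ?thesis using X by simp
qed

section \<open>The greedy order\<close>

lemma greedy_pick_argmax: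
  assumes "finite R" "R \<noteq> {}"
  shows "greedy_pick v c S R \<in> {j \<in> R. \<forall>k\<in>R. ratio v c S k \<le> ratio v c S j}"
    (is "_ \<in> ?M")
proof -
  have "Max (ratio v c S ` R) \<in> ratio v c S ` R" using assms by (intro Max_in) auto
  then obtain j where "j \<in> R" "ratio v c S j = Max (ratio v c S ` R)" by auto
  then have "j \<in> ?M" using assms by auto
  then show ?thesis unfolding greedy_pick_def using assms by (intro Min_in) auto
qed

lemma greedy_pick_in: "finite R \<Longrightarrow> R \<noteq> {} \<Longrightarrow> greedy_pick v c S R \<in> R"
  using greedy_pick_argmax[of R v c S] by simp

text \<open>The products avoid the case distinctions of \<^const>\<open>ratio\<close> on zero costs.\<close>

lemma greedy_pick_cross:
  assumes "valuation_on A v" "cost_vector A c" "finite R" "R \<subseteq> A" "S \<subseteq> A" "k \<in> R"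
    "j = greedy_pick v c S R"
  shows "marginal v k S * c j \<le> c k * marginal v j S"
proof -
  have j: "j \<in> R" "ratio v c S k \<le> ratio v c S j"
    using greedy_pick_argmax[of R v c S] assms by auto
  have nn: "0 \<le> marginal v k S" "0 \<le> marginal v j S" "0 \<le> c j" "0 \<le> c k"
    using assms j marginal_nonneg[of A v S] by (auto simp: cost_vector_def)
  consider "marginal v k S = 0 \<or> c j = 0" | "0 < marginal v k S" "0 < c j" using nn by linarith
  then show ?thesis
  proof cases
    case 2
    \<comment> \<open>The ratio of \<open>k\<close> is positive, hence so is that of
      \<open>j\<close>. As \<open>c j\<close> is positive, the latter is finite, which rules out
      \<open>c k = 0\<close>.\<close>
    then have "marginal v j S \<noteq> 0" "0 < c k"
      using j(2) nn by (auto simp: ratio_def divide_le_0_iff split: if_splits)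
    then show ?thesis using j(2) 2 by (simp add: ratio_def field_simps)
  qed (use nn in auto)
qed

text \<open>A positive marginal value has a positive or infinite ratio, so a pick of ratio 0 shows
  that no remaining item adds anything.\<close>

lemma greedy_pick_marginal_zero:
  assumes "valuation_on A v" "cost_vector A c" "finite R" "R \<subseteq> A" "S \<subseteq> A" "k \<in> R"
    "marginal v (greedy_pick v c S R) S = 0"
  shows "marginal v k S = 0"
proof -
  have "ratio v c S k \<le> ratio v c S (greedy_pick v c S R)"
    using greedy_pick_argmax[of R v c S] assms by auto
  moreover have "0 \<le> marginal v k S" "0 \<le> c k"
    using assms marginal_nonneg[of A v S] by (auto simp: cost_vector_def)
  ultimately show ?thesis
    using assms(7) by (auto simp: ratio_def divide_le_0_iff split: if_splits)
qed

text \<open>The pick has the best value per unit of cost, so spending at most \<open>b\<close>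
  outside \<open>S\<close> gains at most \<open>b\<close> times that rate. The product form also
  covers picks of cost 0.\<close>

lemma greedy_pick_gain:
  assumes "valuation_on A v" "cost_vector A c" "finite R" "R \<subseteq> A" "S \<subseteq> A"
    "finite X" "X \<subseteq> S \<union> R" "j = greedy_pick v c S R" "sum c (X - S) \<le> b" "R \<noteq> {}"
  shows "c j * (v X - v S) \<le> b * marginal v j S"
proof -
  have j: "j \<in> R" using greedy_pick_in[of R v c S] assms by auto
  have nn: "0 \<le> c j" "0 \<le> marginal v j S"
    using assms j marginal_nonneg[of A v S] by (auto simp: cost_vector_def)
  have "v X \<le> v (S \<union> (X - S))" using assms by (intro valuation_mono[of A]) auto
  also have "\<dots> \<le> v S + (\<Sum>x\<in>X-S. marginal v x S)"
    using assms by (intro value_union_le_sum_marginals[of A]) auto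
  finally have "c j * (v X - v S) \<le> c j * (\<Sum>x\<in>X-S. marginal v x S)"
    using nn by (intro mult_left_mono) auto
  also have "\<dots> = (\<Sum>x\<in>X-S. marginal v x S * c j)" by (simp add: sum_distrib_left mult.commute)
  also have "\<dots> \<le> (\<Sum>x\<in>X-S. c x * marginal v j S)"
    using assms by (intro sum_mono greedy_pick_cross[of A]) auto
  also have "\<dots> = sum c (X - S) * marginal v j S" by (simp add: sum_distrib_right)
  also have "\<dots> \<le> b * marginal v j S" using assms nn by (intro mult_right_mono)
  finally show ?thesis .
qed

section \<open>Prefixes and positions of the greedy order\<close>

lemma greedy_set_Suc:
  "greedy_set v c A (Suc k) = insert (greedy_item v c A (Suc k)) (greedy_set v c A k)"
  by (simp add: greedy_item_def)

declare greedy_set.simps(2) [simp del]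

text \<open>Below \<open>card A\<close> some item is always left, so each pick is new. Past
  \<open>card A\<close> the pick would be the minimum of an empty set, hence the bound on
  \<open>k\<close>.\<close>

lemma greedy_set_basics:
  assumes "finite A" "k \<le> card A"
  shows "greedy_set v c A k \<subseteq> A \<and> card (greedy_set v c A k) = k \<and>
    finite (greedy_set v c A k)"
  using assms(2)
proof (induction k)
  case 0
  then show ?case by simp
next
  case (Suc k)
  then have IH: "greedy_set v c A k \<subseteq> A" "card (greedy_set v c A k) = k"
    "finite (greedy_set v c A k)" by auto
  then have "A - greedy_set v c A k \<noteq> {}"
    using Suc.prems assms(1) by (metis Diff_eq_empty_iff card_mono not_less_eq_eq)
  then have "greedy_item v c A (Suc k) \<in> A - greedy_set v c A k"
    unfolding greedy_item_def diff_Suc_1 using assms(1) by (intro greedy_pick_in) auto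
  then show ?case using IH by (auto simp: greedy_set_Suc)
qed

lemma greedy_set_pred:
  assumes "finite A" "k \<in> {1..card A}"
  shows "greedy_set v c A (k - 1) \<subseteq> A" "finite (greedy_set v c A (k - 1))"
  using assms(2) greedy_set_basics[OF assms(1), of "k - 1" v c] by force+

lemma greedy_item_in:
  assumes "finite A" "k \<in> {1..card A}"
  shows "greedy_item v c A k \<in> A - greedy_set v c A (k - 1)"
proof -
  obtain m where m: "k = Suc m" using assms(2) by (cases k) auto
  have "A - greedy_set v c A m \<noteq> {}"
    using greedy_set_basics[of A m v c] assms m
    by (metis Diff_eq_empty_iff Suc_leD atLeastAtMost_iff card_mono not_less_eq_eq)
  then show ?thesis
    unfolding greedy_item_def m diff_Suc_1 using assms(1) by (intro greedy_pick_in) auto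
qed

lemma greedy_set_image: "greedy_set v c A k = greedy_item v c A ` {1..k}"
  by (induction k) (auto simp: greedy_set_Suc atLeastAtMostSuc_conv)

lemma greedy_set_mono: "k \<le> l \<Longrightarrow> greedy_set v c A k \<subseteq> greedy_set v c A l"
  unfolding greedy_set_image by auto

lemma greedy_set_eq_insert:
  assumes "1 \<le> k"
  shows "greedy_set v c A k = insert (greedy_item v c A k) (greedy_set v c A (k - 1))"
  using assms greedy_set_Suc[of v c A "k - 1"] by simp

text \<open>The first \<open>card A\<close> picks form a set of \<open>card A\<close> elements.
  Injectivity allows a seller to be identified with its position.\<close>

lemma greedy_item_inj:
  assumes "finite A"
  shows "inj_on (greedy_item v c A) {1..card A}"
proof -
  have "card (greedy_item v c A ` {1..card A}) = card {1..card A}"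
    using greedy_set_basics[OF assms order.refl, of v c] by (simp add: greedy_set_image)
  then show ?thesis by (simp add: eq_card_imp_inj_on)
qed

lemma greedy_set_card: "finite A \<Longrightarrow> greedy_set v c A (card A) = A"
  using greedy_set_basics[of A "card A" v c] by (simp add: card_subset_eq)

lemma greedy_telescope:
  "(\<Sum>k = 1..n. marginal v (greedy_item v c A k) (greedy_set v c A (k - 1)))
    = v (greedy_set v c A n) - v {}"
  by (induction n) (simp_all add: marginal_def greedy_set_Suc)

section \<open>Lowering one bid\<close>

lemma ratio_antimono_cost:
  assumes "0 \<le> marginal v i S" "0 \<le> c' i" "c' i \<le> c i"
  shows "ratio v c S i \<le> ratio v c' S i"
  using assms by (auto simp: ratio_def intro: divide_left_mono)

lemma ratio_cong: "c' i = c i \<Longrightarrow> ratio v c' S i = ratio v c S i"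
  by (simp add: ratio_def)

lemma greedy_pick_cong:
  assumes "\<And>i. i \<in> R \<Longrightarrow> c' i = c i"
  shows "greedy_pick v c' S R = greedy_pick v c S R"
proof -
  have "{j \<in> R. \<forall>k\<in>R. ratio v c' S k \<le> ratio v c' S j}
      = {j \<in> R. \<forall>k\<in>R. ratio v c S k \<le> ratio v c S j}"
    using assms ratio_cong[of c' _ c v S] by auto
  then show ?thesis by (simp add: greedy_pick_def)
qed

text \<open>Only the ratio of \<open>i\<close> rises. If \<open>i\<close> is still not picked, the
  new pick was a maximiser before, and every old maximiser remains one; so the new pick is also the
  least old maximiser.\<close>

lemma greedy_pick_lower_bid:
  assumes "finite R" "R \<noteq> {}" "\<And>x. x \<in> R \<Longrightarrow> x \<noteq> i \<Longrightarrow> c' x = c x"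
    "i \<in> R \<Longrightarrow> ratio v c S i \<le> ratio v c' S i" "greedy_pick v c' S R \<noteq> i"
  shows "greedy_pick v c S R = greedy_pick v c' S R"
proof -
  let ?M = "\<lambda>c. {j \<in> R. \<forall>k\<in>R. ratio v c S k \<le> ratio v c S j}"
  let ?p = "greedy_pick v c' S R"
  have le: "ratio v c S k \<le> ratio v c' S k" if "k \<in> R" for k
    using assms(3,4) that ratio_cong[of c' k c v S] by (cases "k = i") auto
  have eq: "ratio v c' S k = ratio v c S k" if "k \<in> R" "k \<noteq> i" for k
    using assms(3) that ratio_cong[of c' k c v S] by auto
  have p: "?p \<in> R" "\<And>k. k \<in> R \<Longrightarrow> ratio v c' S k \<le> ratio v c' S ?p"
    using greedy_pick_argmax[of R v c' S] assms by auto
  then have pM: "?p \<in> ?M c" using le eq[of ?p] assms(5) by fastforce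
  have sub: "j \<in> ?M c'" if "j \<in> ?M c" for j
  proof -
    have "ratio v c' S ?p = ratio v c S ?p" using eq p assms(5) by auto
    also have "\<dots> \<le> ratio v c S j" using that p by auto
    also have "\<dots> \<le> ratio v c' S j" using le that by auto
    finally have "ratio v c' S k \<le> ratio v c' S j" if "k \<in> R" for k using p(2)[OF that] by simp
    then show ?thesis using that by simp
  qed
  have "Min (?M c) = ?p"
  proof (rule Min_eqI)
    fix y assume "y \<in> ?M c"
    then have "y \<in> ?M c'" using sub by blast
    then show "?p \<le> y" unfolding greedy_pick_def using assms(1) by (intro Min_le) auto
  qed (use assms pM in auto)
  then show ?thesis by (simp add: greedy_pick_def)
qed

lemma greedy_order_lower_bid:
  assumes "finite A" "valuation_on A v" "k \<in> {1..card A}" "greedy_item v c A k = i"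
    "\<And>x. x \<in> A \<Longrightarrow> x \<noteq> i \<Longrightarrow> c' x = c x" "0 \<le> c' i" "c' i \<le> c i"
  obtains k' where "k' \<in> {1..k}" "greedy_item v c' A k' = i"
    "\<forall>n<k'. greedy_set v c' A n = greedy_set v c A n"
    "\<forall>n<k'. 1 \<le> n \<longrightarrow> greedy_item v c' A n = greedy_item v c A n"
proof -
  let ?T = "greedy_set v c' A" and ?S = "greedy_set v c A"
  have pick: "greedy_item v c' A (Suc n) = greedy_item v c A (Suc n)"
    if n: "n < card A" and eq: "?T n = ?S n" and ne: "greedy_item v c' A (Suc n) \<noteq> i" for n
  proof -
    have sub: "?S n \<subseteq> A" using greedy_set_basics[of A n v c] n assms(1) by auto
    have "ratio v c (?S n) i \<le> ratio v c' (?S n) i" if "i \<in> A - ?S n"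
      using assms that sub by (intro ratio_antimono_cost marginal_nonneg[of A]) auto
    moreover have "A - ?S n \<noteq> {}" using greedy_item_in[of A "Suc n" v c] assms(1) n by auto
    ultimately have "greedy_pick v c (?S n) (A - ?S n) = greedy_pick v c' (?S n) (A - ?S n)"
      using assms ne eq by (intro greedy_pick_lower_bid) (auto simp: greedy_item_def)
    then show ?thesis using eq by (simp add: greedy_item_def)
  qed
  \<comment> \<open>The two prefixes can differ only after \<open>i\<close> has entered the one with
    the lower bid.\<close>
  have agree: "i \<in> ?T n \<or> ?T n = ?S n" if "n \<le> k" for n
    using that
  proof (induction n)
    case (Suc n)
    then have "n < card A" "i \<in> ?T n \<or> ?T n = ?S n" using assms(3) by auto
    then show ?case using pick[of n] unfolding greedy_set_Suc by (metis insertCI)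
  qed simp
  have "i \<in> ?S k" using assms(3,4) greedy_set_eq_insert[of k v c A] by auto
  then have ik: "i \<in> ?T k" using agree[of k] by auto
  \<comment> \<open>The first prefix under the lower bid that contains \<open>i\<close>; its last
    item must be \<open>i\<close>.\<close>
  define k' where "k' = (LEAST n. i \<in> ?T n)"
  have k'T: "i \<in> ?T k'" unfolding k'_def using ik by (rule LeastI)
  have k'k: "k' \<le> k" unfolding k'_def using ik by (rule Least_le)
  have out: "i \<notin> ?T n" if "n < k'" for n using that not_less_Least unfolding k'_def by blast
  have pos: "1 \<le> k'" using k'T by (cases k') auto
  show ?thesis
  proof
    show "k' \<in> {1..k}" using pos k'k by simp
    show "greedy_item v c' A k' = i"
      using k'T out[of "k' - 1"] pos greedy_set_eq_insert[of k' v c' A] by auto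
    have eq: "?T n = ?S n" if "n < k'" for n using agree[of n] out[of n] that k'k by auto
    then show "\<forall>n<k'. ?T n = ?S n" by blast
    have "greedy_item v c' A n = greedy_item v c A n" if "n < k'" "1 \<le> n" for n
    proof -
      have "greedy_item v c' A n \<noteq> i" using out[OF that(1)] that(2) greedy_set_image[of v c' A n]
        by auto
      then show ?thesis using pick[of "n - 1"] eq[of "n - 1"] that k'k assms(3) by auto
    qed
    then show "\<forall>n<k'. 1 \<le> n \<longrightarrow> greedy_item v c' A n = greedy_item v c A n" by blast
  qed
qed

section \<open>Winning sets\<close>

text \<open>The loop invariant says that all indices below the current one passed the test. The loop
  ends one past the last accepted index, hence the shift by one.\<close>

lemma greedy_TM_prefix:
  obtains n where "n \<le> card A" "greedy_TM \<gamma> v c A B = greedy_set v c A n"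
    "\<forall>q\<in>{1..n}. TM_condition \<gamma> v c A B q"
    "n < card A \<longrightarrow> \<not> TM_condition \<gamma> v c A B (Suc n)"
proof -
  let ?C = "\<lambda>k. k \<le> card A \<and> TM_condition \<gamma> v c A B k"
  let ?Q = "\<lambda>k. 1 \<le> k \<and> k \<le> Suc (card A) \<and> (\<forall>q\<in>{1..<k}. TM_condition \<gamma> v c A B q) \<and> \<not> ?C k"
  have "?Q (while ?C Suc 1)"
    by (rule while_rule[where P = "\<lambda>k. 1 \<le> k \<and> k \<le> Suc (card A) \<and>
          (\<forall>q\<in>{1..<k}. TM_condition \<gamma> v c A B q)" and r = "measure (\<lambda>k. Suc (card A) - k)"])
       (auto simp: less_Suc_eq)
  then obtain k where k: "k = while ?C Suc 1" "?Q k" by blast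
  show ?thesis
  proof (rule that[of "k - 1"])
    show "greedy_TM \<gamma> v c A B = greedy_set v c A (k - 1)" by (simp add: greedy_TM_def k(1))
  qed (use k(2) in auto)
qed

lemma greedy_TM_iff:
  assumes "finite A"
  shows "i \<in> greedy_TM \<gamma> v c A B \<longleftrightarrow>
    (\<exists>k\<in>{1..card A}. i = greedy_item v c A k \<and> (\<forall>q\<in>{1..k}. TM_condition \<gamma> v c A B q))"
proof -
  obtain n where n: "n \<le> card A" "greedy_TM \<gamma> v c A B = greedy_set v c A n"
    "\<forall>q\<in>{1..n}. TM_condition \<gamma> v c A B q"
    "n < card A \<longrightarrow> \<not> TM_condition \<gamma> v c A B (Suc n)"
    by (rule greedy_TM_prefix[of A \<gamma> v c B])
  have "k \<le> n" if "k \<in> {1..card A}" "\<forall>q\<in>{1..k}. TM_condition \<gamma> v c A B q" for k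
    using n(4) that by (cases "k \<le> n") auto
  moreover have "k \<in> {1..card A} \<and> (\<forall>q\<in>{1..k}. TM_condition \<gamma> v c A B q)"
    if "k \<in> {1..n}" for k
    using n(1,3) that by auto
  ultimately have "k \<in> {1..n} \<longleftrightarrow>
      k \<in> {1..card A} \<and> (\<forall>q\<in>{1..k}. TM_condition \<gamma> v c A B q)" for k
    by auto
  then show ?thesis unfolding n(2) greedy_set_image by blast
qed

text \<open>Each of the two rules yields a position of the winner in the greedy order; injectivity
  makes these positions equal.\<close>

lemma winner_iff:
  assumes "finite A" and A': "A' = {i \<in> A. c i \<le> B}"
  shows "i \<in> deterministic_large Orc \<alpha> \<gamma> A v B c \<longleftrightarrow>
    (\<exists>k\<in>{1..card A'}. greedy_item v c A' k = i \<and>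
       v (greedy_set v c A' k) \<le> \<alpha> * Orc c (A' - {i}) B \<and>
       (\<forall>q\<in>{1..k}. TM_condition \<gamma> v c A' B q))"
proof -
  have fin: "finite A'" using assms by simp
  have inj: "k = l" if "k \<in> {1..card A'}" "l \<in> {1..card A'}"
    "greedy_item v c A' k = greedy_item v c A' l" for k l
    using greedy_item_inj[OF fin, of v c] that by (meson inj_onD)
  have "i \<in> deterministic_large Orc \<alpha> \<gamma> A v B c \<longleftrightarrow>
      i \<in> greedy_OM Orc \<alpha> v c A' B \<and> i \<in> greedy_TM \<gamma> v c A' B"
    unfolding deterministic_large_def Let_def A' by simp
  also have "i \<in> greedy_OM Orc \<alpha> v c A' B \<longleftrightarrow> (\<exists>k\<in>{1..card A'}. greedy_item v c A' k = i \<and>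
      v (greedy_set v c A' k) \<le> \<alpha> * Orc c (A' - {i}) B)"
    unfolding greedy_OM_def by auto
  also note greedy_TM_iff[OF fin, of i \<gamma> v c B]
  finally show ?thesis using inj by blast
qed

lemma winner_affordable:
  assumes "finite A" "i \<in> deterministic_large Orc \<alpha> \<gamma> A v B c"
  shows "i \<in> A" "c i \<le> B"
proof -
  obtain k where "k \<in> {1..card {i \<in> A. c i \<le> B}}" "greedy_item v c {i \<in> A. c i \<le> B} k = i"
    using winner_iff[OF assms(1) refl] assms(2) by blast
  then show "i \<in> A" "c i \<le> B"
    using greedy_item_in[of "{i \<in> A. c i \<le> B}" k v c] assms(1) by auto
qed

section \<open>Truthfulness\<close>

text \<open>At an earlier position the marginal value of \<open>i\<close> is no smaller and the
  value of the prefix ending in \<open>i\<close> is no larger. Cost per value therefore does not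
  rise, while the allowed bound does not fall.\<close>

lemma TM_condition_lower_bid:
  assumes "finite A" "valuation_on A v" "0 \<le> \<gamma>" "0 < B"
    and k: "k \<in> {1..card A}" "greedy_item v c A k = i" "TM_condition \<gamma> v c A B k"
    and k': "k' \<in> {1..k}" "greedy_item v c' A k' = i"
      "greedy_set v c' A (k' - 1) = greedy_set v c A (k' - 1)"
    and c': "0 \<le> c' i" "c' i \<le> c i"
  shows "TM_condition \<gamma> v c' A B k'"
proof -
  let ?S = "greedy_set v c A" and ?T = "greedy_set v c' A"
  have S: "?S n \<subseteq> A" if "n \<le> k" for n
    using greedy_set_basics[of A n v c] assms(1) k that by auto
  have iA: "i \<in> A" using greedy_item_in[OF assms(1) k(1), of v c] k by auto
  have Tk: "?T k' = insert i (?S (k' - 1))" using greedy_set_eq_insert[of k' v c' A] k' by auto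
  have sub: "?S (k' - 1) \<subseteq> ?S (k - 1)" using k' by (intro greedy_set_mono) auto
  have Sk: "?S k = insert i (?S (k - 1))" using greedy_set_eq_insert[of k v c A] k by auto
  have Skm: "?S (k - 1) \<subseteq> A" using S by simp
  have m: "0 < marginal v i (?S (k - 1))" "c i / marginal v i (?S (k - 1)) \<le> \<gamma> * (B / v (?S k))"
    using k(2,3) marginal_nonneg[OF assms(2) Skm iA] by (auto simp: TM_condition_def Let_def)
  have mm: "marginal v i (?S (k - 1)) \<le> marginal v i (?S (k' - 1))"
    using assms(2) sub Skm iA by (rule marginal_antimono)
  have Tpos: "0 < v (?T k')" using Tk iA sub Skm by (intro valuation_pos[OF assms(2)]) auto
  have "c' i / marginal v i (?S (k' - 1)) \<le> c i / marginal v i (?S (k - 1))"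
    using c' m(1) mm by (intro frac_le) auto
  also have "\<dots> \<le> \<gamma> * (B / v (?S k))" by (rule m(2))
  also have "\<dots> \<le> \<gamma> * (B / v (?T k'))"
  proof -
    have "v (?T k') \<le> v (?S k)"
      using Tk Sk sub S[of k] by (intro valuation_mono[OF assms(2)]) auto
    then show ?thesis using assms(3,4) Tpos by (intro mult_left_mono divide_left_mono) auto
  qed
  finally show ?thesis using k' m(1) mm by (auto simp: TM_condition_def Let_def)
qed

text \<open>The oracle is called without \<open>i\<close>, so its answer ignores the bid of
  \<open>i\<close>, and the tested prefix only shrinks. The stopping tests before the new position
  of \<open>i\<close> are unchanged.\<close>

lemma winner_lower_bid:
  assumes "finite A" "valuation_on A v" "approximation_oracle r A v Orc" "0 \<le> \<alpha>" "0 \<le> \<gamma>" "0 < B"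
    and c: "cost_vector A c" "i \<in> deterministic_large Orc \<alpha> \<gamma> A v B c" "0 \<le> b" "b \<le> c i"
  shows "i \<in> deterministic_large Orc \<alpha> \<gamma> A v B (c(i := b))"
proof -
  let ?c' = "c(i := b)"
  define A' where "A' = {j \<in> A. c j \<le> B}"
  have A'_eq: "A' = {j \<in> A. ?c' j \<le> B}"
    using winner_affordable[OF assms(1) c(2)] c(4) by (auto simp: A'_def)
  have A': "finite A'" "valuation_on A' v" "A' \<subseteq> A"
    using assms(1,2) valuation_on_subset[of A v A'] by (auto simp: A'_def)
  obtain k where k: "k \<in> {1..card A'}" "greedy_item v c A' k = i"
    "v (greedy_set v c A' k) \<le> \<alpha> * Orc c (A' - {i}) B"
    "\<And>q. q \<in> {1..k} \<Longrightarrow> TM_condition \<gamma> v c A' B q"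
    using winner_iff[OF assms(1) A'_def, of i Orc \<alpha> \<gamma> v] c(2) by auto
  obtain k' where k': "k' \<in> {1..k}" "greedy_item v ?c' A' k' = i"
    "\<forall>n<k'. greedy_set v ?c' A' n = greedy_set v c A' n"
    "\<forall>n<k'. 1 \<le> n \<longrightarrow> greedy_item v ?c' A' n = greedy_item v c A' n"
    using greedy_order_lower_bid[OF A'(1,2) k(1,2), of ?c'] c by auto
  have k'1: "k' \<in> {1..card A'}" using k k' by auto
  have "v (greedy_set v ?c' A' k') \<le> \<alpha> * Orc ?c' (A' - {i}) B"
  proof -
    have i: "i \<in> greedy_set v c A' k" using k greedy_set_image[of v c A' k] by auto
    have "greedy_set v ?c' A' k' = insert i (greedy_set v c A' (k' - 1))"
      using greedy_set_eq_insert[of k' v ?c' A'] k' by auto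
    moreover have "k' - 1 \<le> k" using k' by auto
    ultimately have "greedy_set v ?c' A' k' \<subseteq> greedy_set v c A' k"
      using greedy_set_mono[of "k' - 1" k v c A'] i by simp
    then have "v (greedy_set v ?c' A' k') \<le> v (greedy_set v c A' k)"
      using greedy_set_basics[of A' k v c] A' k by (intro valuation_mono[of A']) auto
    moreover have "Orc ?c' (A' - {i}) B = Orc c (A' - {i}) B"
    proof -
      have "cost_vector A ?c'" using c by (auto simp: cost_vector_def)
      moreover have "A' - {i} \<subseteq> A" "\<forall>j\<in>A' - {i}. ?c' j = c j" using A' by auto
      ultimately show ?thesis
        using assms(3,6) c(1) unfolding approximation_oracle_def by blast
    qed
    ultimately show ?thesis using k(3) by simp
  qed
  moreover have "TM_condition \<gamma> v ?c' A' B q" if q: "q \<in> {1..k'}" for q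
  proof (cases "q = k'")
    case True
    have "TM_condition \<gamma> v ?c' A' B k'"
    proof (rule TM_condition_lower_bid[OF A'(1,2) assms(5,6) k(1,2) _ k'(1,2)])
      show "TM_condition \<gamma> v c A' B k" using k(1) k(4)[of k] by simp
      show "greedy_set v ?c' A' (k' - 1) = greedy_set v c A' (k' - 1)" using k'(1) k'(3) by simp
    qed (use c(3,4) in auto)
    then show ?thesis using True by simp
  next
    case False
    then have q: "q < k'" "1 \<le> q" using q by auto
    \<comment> \<open>An item other than \<open>i\<close> has the same cost under both bids, so its
      test carries over.\<close>
    have "greedy_item v c A' q \<noteq> i"
    proof
      assume "greedy_item v c A' q = i"
      moreover have "q \<in> {1..card A'}" "q \<noteq> k" using q k(1) k'(1) by auto
      ultimately show False using greedy_item_inj[OF A'(1), of v c] k(1,2) by (metis inj_onD)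
    qed
    moreover have "TM_condition \<gamma> v c A' B q" using k(4)[of q] q k' by auto
    ultimately show ?thesis
      using k'(3,4) q by (simp add: TM_condition_def)
  qed
  ultimately show ?thesis
    using winner_iff[OF assms(1) A'_eq, of i Orc \<alpha> \<gamma> v] k' k'1 by blast
qed

text \<open>The threshold does not depend on the seller's own bid. It is at least \<open>t\<close>
  if bidding \<open>t\<close> wins and at most \<open>t\<close> if bidding \<open>t\<close> loses,
  so no other bid does better.\<close>

lemma monotone_imp_truthful:
  fixes f :: "'a allocation"
  assumes mono: "\<And>c i b. cost_vector A c \<Longrightarrow> i \<in> A \<Longrightarrow> i \<in> f c \<Longrightarrow> 0 \<le> b \<Longrightarrow> b \<le> c i \<Longrightarrow> i \<in> f (c(i := b))"
    and bounded: "\<And>c i. i \<in> f c \<Longrightarrow> c i \<le> B"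
  shows "truthful A f"
  unfolding truthful_def
proof (intro ballI allI impI)
  fix i t d assume i: "i \<in> A" and t: "0 \<le> (t::real)" and d: "cost_vector A d"
  let ?L = "{b. 0 \<le> b \<and> i \<notin> f (d(i := b))}"
  \<comment> \<open>Some nonnegative bid loses, so the infimum is not that of the empty set.\<close>
  have "max 0 (B + 1) \<in> ?L" using bounded[of i "d(i := max 0 (B + 1))"] by auto
  then have ne: "?L \<noteq> {}" by blast
  have bdd: "bdd_below ?L" by (rule bdd_belowI[of _ 0]) auto
  have ge: "Inf ?L \<ge> t" if "i \<in> f (d(i := t))"
  proof (rule cInf_greatest[OF ne])
    fix b assume b: "b \<in> ?L"
    show "t \<le> b"
    proof (rule ccontr)
      assume "\<not> t \<le> b"
      moreover have "cost_vector A (d(i := t))" using d t by (auto simp: cost_vector_def)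
      ultimately have "i \<in> f (d(i := t, i := b))" using mono[of "d(i := t)" i b] that i b by auto
      then show False using b by simp
    qed
  qed
  have le: "Inf ?L \<le> t" if "i \<notin> f (d(i := t))"
    using that t by (intro cInf_lower[OF _ bdd]) auto
  show "utility f i t d \<le> utility f i t (d(i := t))"
    using ge le by (auto simp: utility_def threshold_payment_def)
qed

lemma deterministic_large_truthful:
  assumes "finite A" "valuation_on A v" "approximation_oracle r A v Orc" "0 \<le> \<alpha>" "0 \<le> \<gamma>" "0 < B"
  shows "truthful A (deterministic_large Orc \<alpha> \<gamma> A v B)"
  using winner_lower_bid[OF assms] winner_affordable(2)[OF assms(1)]
  by (intro monotone_imp_truthful[where B = B]) auto

section \<open>Budget feasibility\<close>

text \<open>The optimum is measured with the declared costs \<open>c\<close>, the greedy order with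
  \<open>d\<close>, where \<open>i\<close> bids \<open>b\<close>. The intended \<open>x\<close> is
  the value of the prefix under \<open>c\<close> that ends in the last winner.\<close>

lemma winning_bid_le:
  assumes "finite A" "valuation_on A v" "cost_vector A c" "0 < r" "0 < B"
    and d: "d = c(i := b)" "0 \<le> b" and k: "k \<in> {1..card A}" "greedy_item v d A k = i"
    and TM: "TM_condition (1 / r) v d A B k"
    and x: "0 < x" "(1 + 1 / r) * x \<le> opt v c A B"
  shows "b \<le> B * marginal v i (greedy_set v d A (k - 1)) / x"
proof -
  let ?T = "greedy_set v d A (k - 1)"
  let ?m = "marginal v i ?T"
  have T: "?T \<subseteq> A" "finite ?T" using greedy_set_pred[OF assms(1) k(1)] by auto
  have iA: "i \<in> A - ?T" using greedy_item_in[OF assms(1) k(1), of v d] k by auto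
  have Tk: "greedy_set v d A k = insert i ?T" using greedy_set_eq_insert[of k v d A] k by auto
  have dA: "cost_vector A d" using assms(3) d by (auto simp: cost_vector_def)
  have pick: "i = greedy_pick v d ?T (A - ?T)" using k by (simp add: greedy_item_def)
  obtain X where X: "X \<subseteq> A" "sum c X \<le> B" "opt v c A B = v X"
    using assms by (metis opt_attained)
  have finX: "finite X" using X assms(1) finite_subset by blast
  \<comment> \<open>Leaving out \<open>i\<close> makes the cost outside \<open>?T\<close> the same
    under \<open>c\<close> and \<open>d\<close>; \<open>i\<close> is put back afterwards at the
    price of its marginal value on top of \<open>?T\<close>.\<close>
  let ?Y = "(X - {i}) \<union> ?T"
  have "sum d (?Y - ?T) = sum c (?Y - ?T)" using d by (intro sum.cong) auto
  also have "\<dots> \<le> sum c X" using assms(3) finX X by (intro sum_cost_mono[of A]) auto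
  also note X(2)
  finally have "sum d (?Y - ?T) \<le> B" .
  then have "d i * (v ?Y - v ?T) \<le> B * ?m"
    using assms(1,2) dA T finX X iA by (intro greedy_pick_gain[OF _ _ _ _ _ _ _ pick]) auto
  moreover have "v X - v (insert i ?T) \<le> v ?Y - v ?T"
  proof -
    have "v X \<le> v (insert i ?Y)" using X T iA by (intro valuation_mono[OF assms(2)]) auto
    moreover have "marginal v i ?Y \<le> ?m"
      using X T iA by (intro marginal_antimono[OF assms(2)]) auto
    ultimately show ?thesis by (simp add: marginal_def)
  qed
  ultimately have gain: "b * (v X - v (insert i ?T)) \<le> B * ?m"
    using d mult_left_mono[of "v X - v (insert i ?T)" "v ?Y - v ?T" b] by simp
  have m: "0 < ?m" "b / ?m \<le> 1 / r * (B / v (insert i ?T))"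
    using TM k Tk d marginal_nonneg[of A v ?T i] assms(2) T iA
    by (auto simp: TM_condition_def Let_def)
  have pos: "0 < v (insert i ?T)" using T iA by (intro valuation_pos[OF assms(2)]) auto
  have "b * x \<le> B * ?m"
  \<comment> \<open>In the first case the optimum exceeds \<open>v (insert i ?T)\<close> by at least
    \<open>x\<close>, and \<open>gain\<close> applies. In the second case the stopping test bounds
    \<open>b\<close>.\<close>
  proof (cases "r * v (insert i ?T) \<le> x")
    case True
    then have "v (insert i ?T) \<le> x / r" using assms(4) by (simp add: field_simps)
    then have "x \<le> v X - v (insert i ?T)" using x X by (simp add: field_simps)
    then show ?thesis using gain d mult_left_mono[of x _ b] by fastforce
  next
    case False
    then have "b * x \<le> b * (r * v (insert i ?T))" using d by (intro mult_left_mono) auto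
    also have "\<dots> \<le> B * ?m" using m pos assms(4) by (simp add: field_simps)
    finally show ?thesis .
  qed
  then show ?thesis using x by (simp add: field_simps)
qed

text \<open>Every nonnegative bid below the threshold wins, so a threshold above \<open>X\<close>
  would leave room for a winning bid above \<open>X\<close>.\<close>

lemma threshold_payment_le:
  assumes "i \<in> f c" "0 \<le> c i" "0 \<le> X" "\<And>b. c i \<le> b \<Longrightarrow> i \<in> f (c(i := b)) \<Longrightarrow> b \<le> X"
  shows "threshold_payment f c i \<le> X"
proof (rule ccontr)
  let ?L = "{b. 0 \<le> b \<and> i \<notin> f (c(i := b))}"
  assume "\<not> ?thesis"
  then have lt: "X < Inf ?L" using assms(1) by (simp add: threshold_payment_def)
  \<comment> \<open>The midpoint lies strictly between \<open>X\<close> and the threshold. The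
    maximum with \<open>c i\<close> brings the bid into the range of the assumption, and
    \<open>c i\<close> itself wins.\<close>
  define b where "b = max (c i) ((X + Inf ?L) / 2)"
  have "i \<in> f (c(i := b))"
  proof (cases "b = c i")
    case False
    then have "0 \<le> b" "b < Inf ?L" using lt assms(3) by (auto simp: b_def max_def)
    moreover have "bdd_below ?L" by (rule bdd_belowI[of _ 0]) auto
    ultimately show ?thesis using cInf_lower[of b ?L] by fastforce
  qed (use assms(1) in simp)
  then have "b \<le> X" using assms(4)[of b] by (simp add: b_def)
  then show False using lt by (simp add: b_def)
qed

lemma deterministic_large_budget_feasible:
  assumes "finite A" "valuation_on A v" "0 < B" "1 \<le> r" "approximation_oracle r A v Orc"
  shows "budget_feasible A B (deterministic_large Orc (r / (r + 1)) (1 / r) A v B)"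
  unfolding budget_feasible_def
proof (intro allI impI)
  fix c assume c: "cost_vector A c"
  let ?f = "deterministic_large Orc (r / (r + 1)) (1 / r) A v B"
  define A' where "A' = {j \<in> A. c j \<le> B}"
  have A': "finite A'" "valuation_on A' v" "A' \<subseteq> A" "cost_vector A' c"
    using assms(1,2) c valuation_on_subset[of A v A'] by (auto simp: A'_def cost_vector_def)
  let ?S = "greedy_set v c A'" and ?g = "greedy_item v c A'"
  define P where "P = {k \<in> {1..card A'}. ?g k \<in> ?f c}"
  have W: "?f c = ?g ` P"
  proof
    show "?f c \<subseteq> ?g ` P"
    proof
      fix i assume i: "i \<in> ?f c"
      then obtain k where "k \<in> {1..card A'}" "?g k = i"
        using winner_iff[OF assms(1) A'_def] by blast
      then show "i \<in> ?g ` P" using i unfolding P_def by blast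
    qed
  qed (auto simp: P_def)
  have inj: "inj_on ?g P" using greedy_item_inj[OF A'(1)] by (rule inj_on_subset) (auto simp: P_def)
  have finP: "finite P" by (simp add: P_def)
  have WA: "?f c \<subseteq> A" by (rule subsetI) (rule winner_affordable(1)[OF assms(1)])
  have "(\<Sum>i\<in>A. threshold_payment ?f c i) = (\<Sum>i\<in>?f c. threshold_payment ?f c i)"
    using WA assms(1) by (intro sum.mono_neutral_right) (auto simp: threshold_payment_def)
  also have "\<dots> = (\<Sum>k\<in>P. threshold_payment ?f c (?g k))" using inj by (simp add: W sum.reindex)
  also have "\<dots> \<le> B"
  proof (cases "P = {}")
    case False
    \<comment> \<open>The position of the last winner: all winners lie in \<open>?S L\<close>, and
      the oracle test at \<open>L\<close> bounds the value of this prefix.\<close>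
    define L where "L = Max P"
    have LP: "L \<in> P" unfolding L_def using finP False by (rule Max_in)
    have PL: "k \<in> {1..L}" if "k \<in> P" for k
      unfolding L_def using that finP by (auto simp: P_def)
    have L: "L \<in> {1..card A'}" using LP by (simp add: P_def)
    define x where "x = v (?S L)"
    have SL: "?S n \<subseteq> A'" if "n \<le> L" for n using greedy_set_basics[of A' n v c] A' L that by auto
    have "?g L \<in> ?S L" using L greedy_set_image[of v c A' L] by auto
    then have xpos: "0 < x" unfolding x_def using SL by (intro valuation_pos[OF A'(2)]) auto
    have "?g L \<in> ?f c" using LP by (simp add: P_def)
    then obtain l where l: "l \<in> {1..card A'}" "?g l = ?g L"
      "v (?S l) \<le> r / (r + 1) * Orc c (A' - {?g L}) B"
      using winner_iff[OF assms(1) A'_def, of "?g L" Orc _ _ v] by blast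
    then have "l = L" using greedy_item_inj[OF A'(1), of v c] L by (meson inj_onD)
    then have "x \<le> r / (r + 1) * Orc c (A' - {?g L}) B" using l by (simp add: x_def)
    also have "\<dots> \<le> r / (r + 1) * opt v c A' B"
    proof (intro mult_left_mono)
      have "Orc c (A' - {?g L}) B \<le> opt v c (A' - {?g L}) B"
        using assms(3,5) c A'(3) unfolding approximation_oracle_def by blast
      also have "\<dots> \<le> opt v c A' B" using A' assms(3) by (intro opt_mono) auto
      finally show "Orc c (A' - {?g L}) B \<le> opt v c A' B" .
    qed (use assms(4) in auto)
    \<comment> \<open>The factor \<open>1 + 1 / r\<close> is the reciprocal of
      \<open>r / (r + 1)\<close>.\<close>
    finally have xopt: "(1 + 1 / r) * x \<le> opt v c A' B" using assms(4) by (simp add: field_simps)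
    have pay: "threshold_payment ?f c (?g k) \<le> B / x * marginal v (?g k) (?S (k - 1))"
      if kP: "k \<in> P" for k
    proof (rule threshold_payment_le)
      let ?i = "?g k"
      have k: "k \<in> {1..card A'}" "k \<in> {1..L}" using kP PL by (auto simp: P_def)
      have iA: "?i \<in> A'" using greedy_item_in[OF A'(1) k(1), of v c] by auto
      show "?i \<in> ?f c" using kP by (simp add: P_def)
      show "0 \<le> c ?i" using iA A'(4) by (auto simp: cost_vector_def)
      have "0 \<le> marginal v ?i (?S (k - 1))"
        using iA SL k by (intro marginal_nonneg[OF A'(2)]) auto
      then show "0 \<le> B / x * marginal v ?i (?S (k - 1))" using xpos assms(3) by simp
      fix b assume b: "c ?i \<le> b" "?i \<in> ?f (c(?i := b))"
      let ?d = "c(?i := b)"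
      have bB: "b \<le> B" using winner_affordable(2)[OF assms(1) b(2)] by simp
      have A'd: "A' = {j \<in> A. ?d j \<le> B}" using bB iA by (auto simp: A'_def)
      obtain q where q: "q \<in> {1..card A'}" "greedy_item v ?d A' q = ?i"
        "TM_condition (1 / r) v ?d A' B q"
        using winner_iff[OF assms(1) A'd, of ?i Orc _ _ v] b(2) by fastforce
      have c0: "0 \<le> c ?i" using iA A'(4) by (auto simp: cost_vector_def)
      have low: "\<And>j. j \<in> A' \<Longrightarrow> j \<noteq> ?i \<Longrightarrow> c j = ?d j" "c ?i \<le> ?d ?i" using b(1) by auto
      \<comment> \<open>Going back from \<open>b\<close> to the declared cost lowers the bid, so
        \<open>?i\<close> moves from position \<open>q\<close> to a position no later, which
        injectivity identifies as \<open>k\<close>.\<close>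
      obtain k' where k': "k' \<in> {1..q}" "?g k' = ?i"
        "\<forall>n<k'. ?S n = greedy_set v ?d A' n"
        "\<forall>n<k'. 1 \<le> n \<longrightarrow> ?g n = greedy_item v ?d A' n"
        by (rule greedy_order_lower_bid[where c = ?d and c' = c, OF A'(1,2) q(1,2) low(1) c0 low(2)])
      have "k' \<in> {1..card A'}" using k'(1) q(1) by simp
      then have "k' = k" using greedy_item_inj[OF A'(1), of v c] k'(2) k(1) by (meson inj_onD)
      then have Seq: "?S (k - 1) = greedy_set v ?d A' (k - 1)" and kq: "k \<le> q"
        using k' k by auto
      have "b \<le> B * marginal v ?i (greedy_set v ?d A' (q - 1)) / x"
        using A' assms(3,4) c0 b(1) q xpos xopt by (intro winning_bid_le[OF A'(1,2,4)]) auto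
      also have "\<dots> \<le> B * marginal v ?i (?S (k - 1)) / x"
      proof (intro divide_right_mono mult_left_mono marginal_antimono[OF A'(2)])
        show "?S (k - 1) \<subseteq> greedy_set v ?d A' (q - 1)"
          unfolding Seq using kq by (intro greedy_set_mono) auto
        show "greedy_set v ?d A' (q - 1) \<subseteq> A'"
          by (rule greedy_set_pred[OF A'(1) q(1)])
      qed (use iA xpos assms(3) in auto)
      finally show "b \<le> B / x * marginal v ?i (?S (k - 1))" by simp
    qed
    have "(\<Sum>k\<in>P. threshold_payment ?f c (?g k))
        \<le> (\<Sum>k\<in>P. B / x * marginal v (?g k) (?S (k - 1)))"
      by (rule sum_mono) (rule pay)
    \<comment> \<open>Positions of losers up to \<open>L\<close> are added with nonnegative terms,
      so that the marginal values telescope.\<close>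
    also have "\<dots> \<le> (\<Sum>k=1..L. B / x * marginal v (?g k) (?S (k - 1)))"
    proof (rule sum_mono2)
      fix k assume "k \<in> {1..L} - P"
      then have "k \<in> {1..card A'}" using L by auto
      then have "?g k \<in> A'" "?S (k - 1) \<subseteq> A'"
        using greedy_item_in[OF A'(1), of k v c] greedy_set_pred[OF A'(1)] by auto
      then show "0 \<le> B / x * marginal v (?g k) (?S (k - 1))"
        using marginal_nonneg[OF A'(2)] xpos assms(3) by simp
    qed (use PL in auto)
    also have "\<dots> = B / x * (x - v {})"
      unfolding sum_distrib_left[symmetric] greedy_telescope by (simp add: x_def)
    also have "\<dots> \<le> B"
      using xpos assms(3) valuation_nonneg[OF A'(2), of "{}"] by (simp add: field_simps)
    finally show ?thesis .
  qed (use assms(3) in simp)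
  finally show "(\<Sum>i\<in>A. threshold_payment ?f c i) \<le> B" .
qed

section \<open>Large markets\<close>

text \<open>A failed test means that the next item offers little value per cost, and by
  \<open>greedy_pick_gain\<close> so does everything left. If it failed because the marginal value
  is 0, nothing left adds value.\<close>

lemma greedy_stop_bound:
  assumes "finite A" "valuation_on A v" "cost_vector A c" "0 < r" "0 < B"
    and n: "n < card A" "\<not> TM_condition (1 / r) v c A B (Suc n)"
  shows "opt v c A B \<le> v (greedy_set v c A n) + r * v (greedy_set v c A (Suc n))"
proof -
  let ?S = "greedy_set v c A n"
  define i where "i = greedy_item v c A (Suc n)"
  let ?m = "marginal v i ?S"
  have S: "?S \<subseteq> A" "finite ?S" using greedy_set_basics[of A n v c] assms(1) n by auto
  have iA: "i \<in> A - ?S" using greedy_item_in[OF assms(1), of "Suc n" v c] n by (auto simp: i_def)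
  have Si: "greedy_set v c A (Suc n) = insert i ?S" by (simp add: greedy_set_Suc i_def)
  have pick: "i = greedy_pick v c ?S (A - ?S)" by (simp add: i_def greedy_item_def)
  have pos: "0 < v (insert i ?S)" using S iA by (intro valuation_pos[OF assms(2)]) auto
  obtain X where X: "X \<subseteq> A" "sum c X \<le> B" "opt v c A B = v X"
    using assms by (metis opt_attained)
  have finX: "finite X" using X assms(1) finite_subset by blast
  have "v X \<le> v ?S + r * v (insert i ?S)"
  proof (cases "?m = 0")
    case True
    have z: "marginal v x ?S = 0" if "x \<in> X - ?S" for x
    proof (rule greedy_pick_marginal_zero[OF assms(2,3)])
      show "marginal v (greedy_pick v c ?S (A - ?S)) ?S = 0" using True pick by simp
    qed (use that X(1) S(1) assms(1) in auto)
    have "v X \<le> v (?S \<union> (X - ?S))" using X S by (intro valuation_mono[OF assms(2)]) auto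
    also have "\<dots> \<le> v ?S + (\<Sum>x\<in>X-?S. marginal v x ?S)"
      using finX X S by (intro value_union_le_sum_marginals[OF assms(2)]) auto
    also have "(\<Sum>x\<in>X-?S. marginal v x ?S) = 0" using z by simp
    finally have "v X \<le> v ?S" by simp
    moreover have "0 \<le> r * v (insert i ?S)" using pos assms(4) by simp
    ultimately show ?thesis by linarith
  next
    case False
    then have m: "0 < ?m" using marginal_nonneg[OF assms(2) S(1), of i] iA by auto
    then have "1 / r * (B / v (insert i ?S)) < c i / ?m"
      using n(2) Si by (simp add: TM_condition_def Let_def i_def[symmetric])
    then have big: "B * ?m < c i * (r * v (insert i ?S))"
      using m pos assms(4) by (simp add: field_simps)
    have "sum c (X - ?S) \<le> sum c X" using X finX by (intro sum_cost_mono[OF assms(3)]) auto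
    then have "c i * (v X - v ?S) \<le> B * ?m"
      using assms(1,2,3) S finX X iA by (intro greedy_pick_gain[OF assms(2,3) _ _ _ _ _ pick]) auto
    then have "c i * (v X - v ?S) < c i * (r * v (insert i ?S))" using big by linarith
    moreover have "0 \<le> c i" using iA assms(3) by (auto simp: cost_vector_def)
    ultimately show ?thesis by (simp add: mult_less_cancel_left)
  qed
  then show ?thesis using X Si by simp
qed

lemma value_greedy_set_Suc:
  assumes "finite A" "valuation_on A v" "n < card A" "\<And>i. i \<in> A \<Longrightarrow> v {i} \<le> \<delta>"
  shows "v (greedy_set v c A (Suc n)) \<le> v (greedy_set v c A n) + \<delta>"
proof -
  have "greedy_item v c A (Suc n) \<in> A" using greedy_item_in[of A "Suc n" v c] assms by auto
  moreover have "greedy_set v c A n \<subseteq> A" using greedy_set_basics[of A n v c] assms by auto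
  ultimately show ?thesis
    using marginal_le_singleton[OF assms(2), of "greedy_set v c A n" "greedy_item v c A (Suc n)"]
      assms(4)[of "greedy_item v c A (Suc n)"] by (simp add: marginal_def greedy_set_Suc)
qed

text \<open>A quantitative form of the large market claim. The winners include a greedy prefix that
  is either the whole set kept by the stopping rule or worth nearly
  \<open>opt / (1 + r)\<close>.\<close>

lemma deterministic_large_bound:
  assumes "finite A" "valuation_on A v" "cost_vector A c" "0 < B" "1 \<le> r"
    "approximation_oracle r A v Orc" "0 \<le> \<delta>" "\<And>i. i \<in> A \<Longrightarrow> v {i} \<le> \<delta>"
  shows "opt v c A B
    \<le> (1 + r) * v (deterministic_large Orc (r / (r + 1)) (1 / r) A v B c) + (r + 2) * \<delta>"
proof -
  let ?f = "deterministic_large Orc (r / (r + 1)) (1 / r) A v B c"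
  define A' where "A' = {j \<in> A. c j \<le> B}"
  have A': "finite A'" "valuation_on A' v" "A' \<subseteq> A" "cost_vector A' c"
    using assms(1-3) valuation_on_subset[of A v A'] by (auto simp: A'_def cost_vector_def)
  have \<delta>: "v {i} \<le> \<delta>" if "i \<in> A'" for i using assms(8) that A' by auto
  let ?S = "greedy_set v c A'" and ?g = "greedy_item v c A'"
  define z where "z = opt v c A' B"
  \<comment> \<open>Prefixes of value at most \<open>x\<close> pass the oracle test: deleting a
    seller costs at most \<open>\<delta>\<close>, and \<open>r / (r + 1)\<close> times the oracle's
    \<open>1 / r\<close> is \<open>1 / (r + 1)\<close>.\<close>
  define x where "x = (z - \<delta>) / (r + 1)"
  have opt: "opt v c A B = z"
    unfolding z_def A'_def using opt_affordable assms(1,3,4) by metis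
  obtain n where n: "n \<le> card A'" "greedy_TM (1 / r) v c A' B = ?S n"
    "\<forall>q\<in>{1..n}. TM_condition (1 / r) v c A' B q"
    "n < card A' \<longrightarrow> \<not> TM_condition (1 / r) v c A' B (Suc n)"
    by (rule greedy_TM_prefix[of A' "1 / r" v c B])
  have WA: "?f \<subseteq> A" by (rule subsetI) (rule winner_affordable(1)[OF assms(1)])
  have TM: "z \<le> (1 + r) * v (?S n) + r * \<delta>"
  proof (cases "n < card A'")
    case True
    have "z \<le> v (?S n) + r * v (?S (Suc n))"
      unfolding z_def using A' assms(4,5) True n(4) by (intro greedy_stop_bound) auto
    also have "r * v (?S (Suc n)) \<le> r * (v (?S n) + \<delta>)"
      using A' True \<delta> assms(5) by (intro mult_left_mono value_greedy_set_Suc) auto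
    finally show ?thesis by (simp add: algebra_simps)
  next
    case False
    then have "?S n = A'" using n(1) A' greedy_set_card[of A' v c] by simp
    moreover have "z \<le> v A'"
      unfolding z_def using A' assms(4)
      by (metis opt_attained valuation_mono subset_refl)
    moreover have "0 \<le> r * v A'" "0 \<le> r * \<delta>"
      using assms(5,7) valuation_nonneg[OF A'(2), of A'] by auto
    ultimately show ?thesis by (simp add: algebra_simps)
  qed
  have OM: "v (?S k) \<le> r / (r + 1) * Orc c (A' - {?g k}) B"
    if "k \<in> {1..card A'}" "v (?S k) \<le> x" for k
  proof -
    have gk: "?g k \<in> A'" using greedy_item_in[OF A'(1) that(1), of v c] by auto
    have "z \<le> opt v c (A' - {?g k}) B + v {?g k}"
      unfolding z_def using A' assms(4) gk by (intro opt_le_opt_delete) auto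
    also have "opt v c (A' - {?g k}) B \<le> r * Orc c (A' - {?g k}) B"
      using assms(3,4,6) A'(3) unfolding approximation_oracle_def by blast
    finally have "z - \<delta> \<le> r * Orc c (A' - {?g k}) B" using \<delta>[OF gk] by simp
    then have "x \<le> r / (r + 1) * Orc c (A' - {?g k}) B"
      using assms(5) by (simp add: x_def divide_right_mono)
    then show ?thesis using that by simp
  qed
  have win: "v (?S m) \<le> v ?f" if m: "m \<le> n" "\<And>k. k \<in> {1..m} \<Longrightarrow> v (?S k) \<le> x" for m
  proof (rule valuation_mono[OF assms(2) _ WA])
    show "?S m \<subseteq> ?f"
    proof
      fix i assume "i \<in> ?S m"
      then obtain k where k: "k \<in> {1..m}" "i = ?g k" unfolding greedy_set_image by blast
      then have "k \<in> {1..card A'}" using m n by auto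
      moreover from this have "v (?S k) \<le> r / (r + 1) * Orc c (A' - {i}) B"
        using OM[of k] m(2) k by simp
      moreover have "\<forall>q\<in>{1..k}. TM_condition (1 / r) v c A' B q" using n(3) k m by auto
      ultimately show "i \<in> ?f"
        using winner_iff[OF assms(1) A'_def, of i Orc _ _ v] k by blast
    qed
  qed
  have mono: "v (?S k) \<le> v (?S l)" if "k \<le> l" "l \<le> card A'" for k l
    using greedy_set_mono[OF that(1)] greedy_set_basics[OF A'(1) that(2), of v c]
    by (intro valuation_mono[OF A'(2)]) auto
  have "v (?S n) \<le> v ?f \<or> x - \<delta> \<le> v ?f"
  proof (cases "v (?S n) \<le> x")
    case True
    then have "v (?S k) \<le> x" if "k \<in> {1..n}" for k using mono[of k n] that n by auto
    then show ?thesis using win[of n] by auto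
  next
    case False
    \<comment> \<open>The first prefix worth more than \<open>x\<close>. All shorter ones pass the
      oracle test, and the one just before, if any, is worth at least
      \<open>x - \<delta>\<close>.\<close>
    define k where "k = (LEAST k. x < v (?S k))"
    have k: "x < v (?S k)" unfolding k_def by (rule LeastI[of _ n]) (use False in auto)
    have kn: "k \<le> n" unfolding k_def by (rule Least_le) (use False in auto)
    have below: "v (?S l) \<le> x" if "l < k" for l
      using not_less_Least[of l "\<lambda>k. x < v (?S k)"] that by (auto simp: k_def)
    have "x - \<delta> \<le> v ?f"
    proof (cases k)
      case 0
      then have "x < v (?S 0)" using k by simp
      also have "\<dots> \<le> v ?f" by (rule win) auto
      finally show ?thesis using assms(7) by simp
    next
      case (Suc l)
      have "v (?S l) \<le> v ?f" using Suc kn below by (intro win) auto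
      moreover have "v (?S (Suc l)) \<le> v (?S l) + \<delta>"
        using A' Suc kn n \<delta> by (intro value_greedy_set_Suc) auto
      ultimately show ?thesis using k Suc by simp
    qed
    then show ?thesis ..
  qed
  \<comment> \<open>The first case loses \<open>r * \<delta>\<close>. The second loses
    \<open>\<delta>\<close> inside \<open>x\<close> and \<open>(1 + r) * \<delta>\<close> for the
    last step, which gives \<open>r + 2\<close> in total.\<close>
  then show ?thesis
  proof
    assume "v (?S n) \<le> v ?f"
    then have "(1 + r) * v (?S n) \<le> (1 + r) * v ?f" using assms(5) by (intro mult_left_mono) auto
    then show ?thesis using TM opt assms(7) by (simp add: algebra_simps)
  next
    assume "x - \<delta> \<le> v ?f"
    then have "(1 + r) * (x - \<delta>) \<le> (1 + r) * v ?f" using assms(5) by (intro mult_left_mono) auto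
    moreover have "(1 + r) * x = z - \<delta>" using assms(5) by (simp add: x_def add.commute)
    ultimately show ?thesis using opt by (simp add: algebra_simps)
  qed
qed

lemma deterministic_large_approximation:
  fixes Orc :: "'a::linorder set \<Rightarrow> 'a valuation \<Rightarrow> 'a value_oracle"
  assumes "1 \<le> r"
    "\<And>A v. finite A \<Longrightarrow> valuation_on A v \<Longrightarrow> approximation_oracle r A v (Orc A v)"
  shows "large_market_approximation (1 + r)
    (\<lambda>A v B. deterministic_large (Orc A v) (r / (r + 1)) (1 / r) A v B)"
  unfolding large_market_approximation_def
proof (intro allI impI)
  fix \<epsilon> :: real assume \<epsilon>: "0 < \<epsilon>"
  \<comment> \<open>Chosen so that the additive loss is the fraction
    \<open>\<epsilon> / (1 + r + \<epsilon>)\<close> of the optimum, leaving exactly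
    \<open>(1 + r) / (1 + r + \<epsilon>)\<close> of it.\<close>
  define \<theta>\<^sub>0 where "\<theta>\<^sub>0 = \<epsilon> / ((1 + r + \<epsilon>) * (r + 2))"
  have \<theta>: "0 < \<theta>\<^sub>0" "(r + 2) * \<theta>\<^sub>0 = \<epsilon> / (1 + r + \<epsilon>)"
    using \<epsilon> assms(1) by (auto simp: \<theta>\<^sub>0_def)
  show "\<exists>\<theta>\<^sub>0>0. \<forall>(A :: 'a set) v B c.
      market A v B \<longrightarrow> cost_vector A c \<longrightarrow> 0 < opt v c A B \<longrightarrow> market_theta A v B c \<le> \<theta>\<^sub>0 \<longrightarrow>
      opt v c A B
        \<le> (1 + r + \<epsilon>) * v (deterministic_large (Orc A v) (r / (r + 1)) (1 / r) A v B c)"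
  proof (intro exI[of _ \<theta>\<^sub>0] conjI allI impI)
    fix A :: "'a set" and v B c
    assume m: "market A v B" and c: "cost_vector A c" and pos: "0 < opt v c A B"
      and small: "market_theta A v B c \<le> \<theta>\<^sub>0"
    let ?w = "v (deterministic_large (Orc A v) (r / (r + 1)) (1 / r) A v B c)"
    have A: "finite A" "valuation_on A v" "0 < B" using m by (auto simp: market_def)
    have "v {i} \<le> \<theta>\<^sub>0 * opt v c A B" if "i \<in> A" for i
    proof -
      have "v {i} \<le> Max ((\<lambda>i. v {i}) ` A)" using A that by (intro Max_ge) auto
      also have "\<dots> \<le> \<theta>\<^sub>0 * opt v c A B"
        using small pos by (simp add: market_theta_def pos_divide_le_eq)
      finally show ?thesis .
    qed
    then have "opt v c A B \<le> (1 + r) * ?w + (r + 2) * (\<theta>\<^sub>0 * opt v c A B)"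
      using A c assms pos \<theta> by (intro deterministic_large_bound) auto
    also have "(r + 2) * (\<theta>\<^sub>0 * opt v c A B) = \<epsilon> / (1 + r + \<epsilon>) * opt v c A B"
      using \<theta>(2) by (metis mult.assoc)
    finally have "opt v c A B * (1 - \<epsilon> / (1 + r + \<epsilon>)) \<le> (1 + r) * ?w"
      by (simp add: algebra_simps)
    also have "1 - \<epsilon> / (1 + r + \<epsilon>) = (1 + r) / (1 + r + \<epsilon>)"
      using \<epsilon> assms(1) by (simp add: field_simps)
    finally have "(1 + r) * opt v c A B \<le> (1 + r) * ((1 + r + \<epsilon>) * ?w)"
      using \<epsilon> assms(1) by (simp add: pos_divide_le_eq mult_ac)
    then show "opt v c A B \<le> (1 + r + \<epsilon>) * ?w" using assms(1) by (simp add: mult_le_cancel_left)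
  qed (use \<theta> in auto)
qed

section \<open>Sviridenko's greedy algorithm\<close>

lemma sviridenko_step_cong:
  assumes "\<And>i. i \<in> S \<union> R \<Longrightarrow> c' i = c i" "finite R" "R \<noteq> {}"
  shows "sviridenko_step v c' B (S, R) = sviridenko_step v c B (S, R)"
proof -
  have p: "greedy_pick v c' S R = greedy_pick v c S R" using assms by (intro greedy_pick_cong) auto
  moreover have "greedy_pick v c S R \<in> R" using assms by (intro greedy_pick_in)
  moreover have "sum c' S = sum c S" using assms(1) by (intro sum.cong) auto
  ultimately show ?thesis using assms(1) by (simp add: sviridenko_step_def Let_def)
qed

text \<open>Carries any invariant \<open>I\<close> along with the bookkeeping. Each step removes
  exactly one item from \<open>R\<close>, so \<open>R\<close> is nonempty before each step and the
  pick lies in it.\<close>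

lemma sviridenko_run_invariant:
  assumes "finite A" "U \<subseteq> A" "n \<le> card (A - U)" "I (U, A - U)"
    "\<And>S R. I (S, R) \<Longrightarrow> S \<union> R \<subseteq> A \<Longrightarrow> R \<noteq> {} \<Longrightarrow> I (sviridenko_step v c B (S, R))"
  shows "case (sviridenko_step v c B ^^ n) (U, A - U) of
    (S, R) \<Rightarrow> I (S, R) \<and> S \<union> R \<subseteq> A \<and> U \<subseteq> S \<and> card R = card (A - U) - n"
  using assms(3)
proof (induction n)
  case 0
  then show ?case using assms by auto
next
  case (Suc n)
  obtain S R where SR: "(sviridenko_step v c B ^^ n) (U, A - U) = (S, R)" by fastforce
  then have IH: "I (S, R)" "S \<union> R \<subseteq> A" "U \<subseteq> S" "card R = card (A - U) - n" using Suc by auto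
  then have fin: "finite R" "R \<noteq> {}" using Suc.prems assms(1) finite_subset[of R A] by auto
  have j: "greedy_pick v c S R \<in> R" using fin by (rule greedy_pick_in)
  obtain S' R' where S'R': "sviridenko_step v c B (S, R) = (S', R')" by fastforce
  have "R' = R - {greedy_pick v c S R}" "S \<subseteq> S'" "S' \<subseteq> insert (greedy_pick v c S R) S"
    using S'R' by (auto simp: sviridenko_step_def Let_def split: if_splits)
  moreover have "I (S', R')" using assms(5)[OF IH(1,2) fin(2)] S'R' by simp
  ultimately show ?case using IH j fin SR S'R' by (auto simp: card_Diff_singleton)
qed

lemma sviridenko_extend_invariant:
  assumes "finite A" "U \<subseteq> A" "I (U, A - U)"
    "\<And>S R. I (S, R) \<Longrightarrow> S \<union> R \<subseteq> A \<Longrightarrow> R \<noteq> {} \<Longrightarrow> I (sviridenko_step v c B (S, R))"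
  shows "I (sviridenko_extend v c A B U, {})" "sviridenko_extend v c A B U \<subseteq> A"
    "U \<subseteq> sviridenko_extend v c A B U"
proof -
  obtain S R where SR: "(sviridenko_step v c B ^^ card (A - U)) (U, A - U) = (S, R)" by fastforce
  have "case (sviridenko_step v c B ^^ card (A - U)) (U, A - U) of
    (S, R) \<Rightarrow> I (S, R) \<and> S \<union> R \<subseteq> A \<and> U \<subseteq> S \<and> card R = card (A - U) - card (A - U)"
    using assms by (intro sviridenko_run_invariant) auto
  then have *: "I (S, R)" "S \<union> R \<subseteq> A" "U \<subseteq> S" "card R = 0" unfolding SR by auto
  then have "R = {}" using assms(1) finite_subset[of R A] by auto
  then show "I (sviridenko_extend v c A B U, {})" "sviridenko_extend v c A B U \<subseteq> A"
    "U \<subseteq> sviridenko_extend v c A B U"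
    using * SR by (auto simp: sviridenko_extend_def)
qed

text \<open>Every state of the run stays inside \<open>A\<close>, so only costs of sellers in
  \<open>A\<close> are consulted, as an oracle must guarantee.\<close>

lemma sviridenko_extend_cong:
  assumes "finite A" "U \<subseteq> A" "\<And>i. i \<in> A \<Longrightarrow> c' i = c i"
  shows "sviridenko_extend v c' A B U = sviridenko_extend v c A B U"
proof -
  have "(sviridenko_step v c' B ^^ n) (U, A - U) = (sviridenko_step v c B ^^ n) (U, A - U)"
    if "n \<le> card (A - U)" for n
    using that
  proof (induction n)
    case (Suc n)
    obtain S R where SR: "(sviridenko_step v c B ^^ n) (U, A - U) = (S, R)" by fastforce
    have "case (sviridenko_step v c B ^^ n) (U, A - U) of
      (S, R) \<Rightarrow> True \<and> S \<union> R \<subseteq> A \<and> U \<subseteq> S \<and> card R = card (A - U) - n"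
      using assms Suc.prems by (intro sviridenko_run_invariant) auto
    then have "S \<union> R \<subseteq> A" "card R = card (A - U) - n" unfolding SR by auto
    moreover from this have "finite R" "R \<noteq> {}"
      using Suc.prems assms(1) finite_subset[of R A] by auto
    ultimately have "sviridenko_step v c' B (S, R) = sviridenko_step v c B (S, R)"
      using assms(3) by (intro sviridenko_step_cong) auto
    then show ?case using Suc SR by simp
  qed simp
  then show ?thesis by (simp add: sviridenko_extend_def)
qed

lemma sviridenko_extend_feasible:
  assumes "finite A" "U \<subseteq> A" "sum c U \<le> B"
  shows "sum c (sviridenko_extend v c A B U) \<le> B"
proof -
  let ?I = "\<lambda>(S :: 'a set, R :: 'a set). sum c S \<le> B"
  have "?I (sviridenko_extend v c A B U, {})"
  proof (rule sviridenko_extend_invariant(1)[OF assms(1,2)])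
    fix S R :: "'a set"
    assume *: "?I (S, R)" "S \<union> R \<subseteq> A"
    then have "finite S" using assms(1) finite_subset by blast
    then show "?I (sviridenko_step v c B (S, R))"
      using * by (auto simp: sviridenko_step_def Let_def sum.insert_if add.commute)
  qed (use assms in auto)
  then show ?thesis by simp
qed

text \<open>As long as no item of \<open>X\<close> is discarded, the gap to \<open>v X\<close> shrinks by the factor
  \<open>exp (- cost / (B - c U))\<close>. When the first such item is discarded, adding it would have exceeded the
  budget, hence would have closed all but \<open>1 / e\<close> of the gap.\<close>

lemma sviridenko_extend_bound:
  assumes "finite A" "valuation_on A v" "cost_vector A c" "U \<subseteq> X" "X \<subseteq> A" "sum c X \<le> B"
    and small: "\<And>x S. x \<in> X - U \<Longrightarrow> U \<subseteq> S \<Longrightarrow> S \<subseteq> A \<Longrightarrow> marginal v x S \<le> exp (- 1) * v U"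
  shows "(1 - exp (- 1)) * v X \<le> v (sviridenko_extend v c A B U)"
proof -
  define b where "b = B - sum c U"
  define e where "e = exp (- 1 :: real)"
  have e: "0 < e" "e < 1" by (auto simp: e_def)
  have finX: "finite X" and UA: "U \<subseteq> A" using assms finite_subset by auto
  have XU: "sum c (X - U) \<le> b"
    using assms(4,6) finX by (simp add: b_def sum_diff finite_subset)
  have gap: "0 \<le> v X - v U" using valuation_mono[OF assms(2,4,5)] by simp
  \<comment> \<open>Either the target value is reached, or no item of \<open>X\<close> has been
    discarded and the gap to \<open>v X\<close> has shrunk exponentially in the cost spent beyond
    \<open>U\<close>.\<close>
  let ?J = "\<lambda>S R. U \<subseteq> S \<and> S \<inter> R = {} \<and> sum c S \<le> B \<and>
    ((1 - e) * v X \<le> v S \<or>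
     X \<subseteq> S \<union> R \<and> (0 < b \<longrightarrow> v X - v S \<le> exp (- (sum c S - sum c U) / b) * (v X - v U)))"
  let ?I = "\<lambda>(S, R). ?J S R"
  have "?I (sviridenko_extend v c A B U, {})"
  proof (rule sviridenko_extend_invariant(1)[OF assms(1) UA])
    have "sum c U \<le> B" using sum_cost_mono[OF assms(3) finX assms(4,5)] assms(6) by simp
    then show "?I (U, A - U)" using assms(5) by auto
  next
    fix S R assume I: "?I (S, R)" and SR: "S \<union> R \<subseteq> A" "R \<noteq> {}"
    have J: "?J S R" using I by simp
    define j where "j = greedy_pick v c S R"
    have fin: "finite S" "finite R" using SR assms(1) finite_subset by auto
    have j: "j \<in> R" "j \<notin> S" "j \<in> A"
      using greedy_pick_in[OF fin(2) SR(2), of v c S] J SR(1) unfolding j_def by blast+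
    have cS: "sum c (insert j S) = sum c S + c j" using fin j by simp
    have mono: "v S \<le> v (insert j S)" using j SR by (intro valuation_mono[OF assms(2)]) auto
    \<comment> \<open>It is not assumed that \<open>j\<close> fits, so this also covers a discarded
      item. By \<open>greedy_pick_gain\<close> the gap shrinks by the factor
      \<open>1 - c j / b\<close>, which is at most \<open>exp (- (c j / b))\<close>.\<close>
    have step: "v X - v (insert j S) \<le> exp (- (sum c (insert j S) - sum c U) / b) * (v X - v U)"
      if b: "0 < b" and X: "X \<subseteq> S \<union> R"
        and IH: "v X - v S \<le> exp (- (sum c S - sum c U) / b) * (v X - v U)"
    proof (cases "v X \<le> v S")
      case True
      then have "v X - v (insert j S) \<le> 0" using mono by simp
      also have "0 \<le> exp (- (sum c (insert j S) - sum c U) / b) * (v X - v U)"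
        using gap by simp
      finally show ?thesis .
    next
      case False
      have "sum c (X - S) \<le> sum c (X - U)"
        using I finX assms(5) by (intro sum_cost_mono[OF assms(3)]) auto
      then have "c j * (v X - v S) \<le> b * marginal v j S"
        using XU SR fin finX X
        by (intro greedy_pick_gain[OF assms(2,3) _ _ _ _ _ j_def]) auto
      then have "c j / b * (v X - v S) \<le> marginal v j S" using b by (simp add: field_simps)
      then have "v X - v (insert j S) \<le> (1 - c j / b) * (v X - v S)"
        by (simp add: marginal_def algebra_simps)
      also have "\<dots> \<le> exp (- (c j / b)) * (v X - v S)"
        using False exp_ge_add_one_self[of "- (c j / b)"] by (intro mult_right_mono) auto
      also have "\<dots> \<le> exp (- (c j / b)) * (exp (- (sum c S - sum c U) / b) * (v X - v U))"
        using IH by (intro mult_left_mono) auto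
      also have "\<dots> = exp (- (sum c (insert j S) - sum c U) / b) * (v X - v U)"
      proof -
        have "- (sum c (insert j S) - sum c U) / b = - (c j / b) + - (sum c S - sum c U) / b"
          by (simp add: cS diff_divide_distrib add_divide_distrib)
        then show ?thesis by (simp only: exp_add mult.assoc)
      qed
      finally show ?thesis .
    qed
    show "?I (sviridenko_step v c B (S, R))"
    proof (cases "sum c S + c j \<le> B")
      case True
      then have st: "sviridenko_step v c B (S, R) = (insert j S, R - {j})"
        by (simp add: sviridenko_step_def Let_def j_def)
      have fits: "sum c (insert j S) \<le> B" using True cS by simp
      have "?J (insert j S) (R - {j})"
      proof (cases "(1 - e) * v X \<le> v S")
        case True
        then have "(1 - e) * v X \<le> v (insert j S)" using mono by linarith
        moreover have "U \<subseteq> insert j S" "insert j S \<inter> (R - {j}) = {}" using J by blast+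
        ultimately show ?thesis using fits by blast
      next
        case False
        then have X: "X \<subseteq> S \<union> R"
          and IH: "0 < b \<Longrightarrow> v X - v S \<le> exp (- (sum c S - sum c U) / b) * (v X - v U)"
          using J by blast+
        have "X \<subseteq> insert j S \<union> (R - {j})" using X by blast
        moreover have "U \<subseteq> insert j S" "insert j S \<inter> (R - {j}) = {}" using J by blast+
        moreover have "0 < b \<longrightarrow>
            v X - v (insert j S) \<le> exp (- (sum c (insert j S) - sum c U) / b) * (v X - v U)"
          using step X IH by blast
        ultimately show ?thesis using fits by blast
      qed
      then show ?thesis unfolding st prod.case .
    next
      case False
      then have st: "sviridenko_step v c B (S, R) = (S, R - {j})"
        by (simp add: sviridenko_step_def Let_def j_def)
      \<comment> \<open>The first discarded item of \<open>X\<close>: with it the cost beyond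
        \<open>U\<close> would exceed \<open>b\<close>, leaving a gap of at most
        \<open>e * (v X - v U)\<close>. Its own marginal value is at most \<open>e * v U\<close>, so
        \<open>S\<close> alone is within \<open>e * v X\<close>.\<close>
      have "(1 - e) * v X \<le> v S" if nd: "\<not> (1 - e) * v X \<le> v S" "j \<in> X"
      proof -
        have X: "X \<subseteq> S \<union> R"
          and IH: "0 < b \<Longrightarrow> v X - v S \<le> exp (- (sum c S - sum c U) / b) * (v X - v U)"
          using J nd(1) by blast+
        have jU: "j \<in> X - U" using nd j J by blast
        have "sum c S \<le> B" using J by blast
        then have "c j > 0" using False by simp
        moreover have "c j \<le> sum c (X - U)"
          using sum_cost_mono[OF assms(3), of "X - U" "{j}"] jU finX assms(5) by auto
        ultimately have b: "0 < b" using XU by simp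
        have "v X - v (insert j S) \<le> exp (- (sum c (insert j S) - sum c U) / b) * (v X - v U)"
          using step[OF b X IH[OF b]] .
        also have "\<dots> \<le> e * (v X - v U)"
        proof (intro mult_right_mono gap)
          have "1 \<le> (sum c (insert j S) - sum c U) / b"
            using b False cS by (simp add: b_def)
          then show "exp (- (sum c (insert j S) - sum c U) / b) \<le> e"
            unfolding e_def minus_divide_left[symmetric] by simp
        qed
        finally have 1: "v X - v (insert j S) \<le> e * (v X - v U)" .
        have "marginal v j S \<le> e * v U" unfolding e_def using jU J SR(1) by (intro small) blast+
        then show ?thesis using 1 by (simp add: marginal_def algebra_simps)
      qed
      then have "?J S (R - {j})" using J by blast
      then show ?thesis unfolding st prod.case .
    qed
  qed
  then have J: "?J (sviridenko_extend v c A B U) {}" unfolding prod.case .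
  have le: "(1 - e) * v X \<le> v X"
    using e valuation_nonneg[OF assms(2,5)] by (simp add: mult_left_le_one_le)
  have EA: "sviridenko_extend v c A B U \<subseteq> A"
    by (rule sviridenko_extend_invariant(2)[OF assms(1) UA, of "\<lambda>_. True"]) auto
  show ?thesis
  \<comment> \<open>No item is left, so the second alternative of the invariant amounts to
    \<open>X\<close> being contained in the solution.\<close>
  proof (cases "X \<subseteq> sviridenko_extend v c A B U")
    case True
    then show ?thesis using le valuation_mono[OF assms(2) True EA] by (simp add: e_def)
  next
    case False
    then show ?thesis using J by (simp add: e_def)
  qed
qed

text \<open>Taking the items of \<open>X\<close> greedily by marginal value, each remaining one adds at most a third
  of the value of the first three.\<close>

lemma top_three:
  assumes "valuation_on A v" "finite X" "X \<subseteq> A" "3 \<le> card X"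
  obtains U where "U \<subseteq> X" "card U = 3"
    "\<forall>x\<in>X - U. \<forall>S. U \<subseteq> S \<longrightarrow> S \<subseteq> A \<longrightarrow> 3 * marginal v x S \<le> v U"
proof -
  have pick: "\<exists>j\<in>X - S. \<forall>x\<in>X - S. marginal v x S \<le> marginal v j S" if "card S < 3" "finite S" for S
  proof -
    have ne: "X - S \<noteq> {}" using that assms(4) card_mono[of S X] by auto
    have "Max ((\<lambda>x. marginal v x S) ` (X - S)) \<in> (\<lambda>x. marginal v x S) ` (X - S)"
      using ne assms(2) by (intro Max_in) auto
    then obtain j where "j \<in> X - S" "marginal v j S = Max ((\<lambda>x. marginal v x S) ` (X - S))"
      by auto
    then show ?thesis using assms(2) by (intro bexI[of _ j]) auto
  qed
  obtain a where a: "a \<in> X" "\<And>x. x \<in> X \<Longrightarrow> marginal v x {} \<le> marginal v a {}"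
    using pick[of "{}"] by auto
  obtain b where b: "b \<in> X - {a}" "\<And>x. x \<in> X - {a} \<Longrightarrow> marginal v x {a} \<le> marginal v b {a}"
    using pick[of "{a}"] by auto
  have "card {a,b} < 3" by (simp add: card_insert_if)
  then obtain d where d: "d \<in> X - {a,b}" "\<And>x. x \<in> X - {a,b} \<Longrightarrow> marginal v x {a,b} \<le> marginal v d {a,b}"
    using pick[of "{a,b}"] by (auto simp del: Diff_iff)
  show ?thesis
  proof (rule that[of "{a,b,d}"])
    show "{a,b,d} \<subseteq> X" "card {a,b,d} = 3" using a b d by auto
    show "\<forall>x\<in>X - {a,b,d}. \<forall>S. {a,b,d} \<subseteq> S \<longrightarrow> S \<subseteq> A \<longrightarrow> 3 * marginal v x S \<le> v {a,b,d}"
    proof (intro ballI allI impI)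
      fix x S assume x: "x \<in> X - {a,b,d}" and S: "{a,b,d} \<subseteq> S" "S \<subseteq> A"
      have le: "marginal v x S \<le> marginal v x T" if "T \<subseteq> S" for T
        using x S assms(3) that by (intro marginal_antimono[OF assms(1)]) auto
      have "marginal v x S \<le> marginal v a {}" using le[of "{}"] a(2)[of x] x by simp
      moreover have "marginal v x S \<le> marginal v b {a}" using le[of "{a}"] b(2)[of x] x S by simp
      moreover have "marginal v x S \<le> marginal v d {a,b}"
        using le[of "{a,b}"] d(2)[of x] x S by simp
      \<comment> \<open>The three greedy marginal values telescope, and each of them is at least the
        marginal value of \<open>x\<close> on top of \<open>S\<close>.\<close>
      moreover have "marginal v a {} + marginal v b {a} + marginal v d {a,b} = v {a,b,d} - v {}"
        by (simp add: marginal_def insert_commute)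
      moreover have "0 \<le> v {}" using valuation_nonneg[OF assms(1)] by simp
      ultimately show "3 * marginal v x S \<le> v {a,b,d}" by linarith
    qed
  qed
qed

text \<open>The lower bound is the partial sum of six Taylor terms. The remainder is at most
  \<open>exp 1 / 720\<close>, and solving for \<open>exp 1\<close> gives the upper bound.\<close>

lemma exp_one_bounds: "163/60 \<le> exp (1::real)" "exp (1::real) < 273/100"
proof -
  obtain t :: real where t: "\<bar>t\<bar> \<le> \<bar>1\<bar>"
    "exp 1 = (\<Sum>m<6. 1 ^ m / fact m) + exp t / fact 6 * 1 ^ 6"
    using Maclaurin_exp_le[of 1 6] by blast
  then have "exp 1 = 163/60 + exp t / 720"
    by (simp add: eval_nat_numeral lessThan_Suc)
  moreover have "0 < exp t" "exp t \<le> exp 1" using t(1) by auto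
  ultimately show "163/60 \<le> exp (1::real)" "exp (1::real) < 273/100" by linarith+
qed

text \<open>Optimal sets of at most two items are enumerated. For larger ones
  \<open>top_three\<close> supplies a start \<open>U\<close> whose later marginal values are at most
  \<open>v U / 3\<close>, which is below the required \<open>v U / e\<close> because
  \<open>e < 3\<close>.\<close>

lemma sviridenko_approximation_oracle:
  assumes A: "finite A" "valuation_on A v"
  shows "approximation_oracle (exp 1 / (exp 1 - 1)) A v (sviridenko v)"
  unfolding approximation_oracle_def
proof (intro allI impI conjI)
  fix A' and B :: real and c :: "'a costs"
  assume A': "A' \<subseteq> A" and B: "0 < B" and c: "cost_vector A c"
  have fin: "finite A'" using A(1) A' by (rule finite_subset[rotated])
  have val: "valuation_on A' v" using A(2) A' by (rule valuation_on_subset)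
  have c': "cost_vector A' c" using c A' by (rule cost_vector_subset)
  let ?F = "\<lambda>c. {U. U \<subseteq> A' \<and> card U \<le> 2 \<and> sum c U \<le> B} \<union>
      sviridenko_extend v c A' B ` {U. U \<subseteq> A' \<and> card U = 3 \<and> sum c U \<le> B}"
  {
    fix d assume d: "cost_vector A d" "\<forall>i\<in>A'. d i = c i"
    have s: "sum d U = sum c U" if "U \<subseteq> A'" for U using d that by (intro sum.cong) auto
    have "sviridenko_extend v d A' B U = sviridenko_extend v c A' B U" if "U \<subseteq> A'" for U
      using d that fin by (intro sviridenko_extend_cong) auto
    then have "sviridenko_extend v d A' B ` {U. U \<subseteq> A' \<and> card U = 3 \<and> sum d U \<le> B}
        = sviridenko_extend v c A' B ` {U. U \<subseteq> A' \<and> card U = 3 \<and> sum c U \<le> B}"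
      using s by (intro image_cong) auto
    moreover have "{U. U \<subseteq> A' \<and> card U \<le> 2 \<and> sum d U \<le> B}
        = {U. U \<subseteq> A' \<and> card U \<le> 2 \<and> sum c U \<le> B}"
      using s by auto
    ultimately have "?F d = ?F c" by simp
    then show "sviridenko v d A' B = sviridenko v c A' B" by (simp add: sviridenko_def)
  }
  have finF: "finite (?F c)" using fin by auto
  have "{} \<in> ?F c" using B by auto
  then have "?F c \<noteq> {}" by blast
  then have "sviridenko v c A' B \<in> v ` ?F c"
    unfolding sviridenko_def by (intro Max_in finite_imageI finF) (simp only: image_is_empty not_False_eq_True)
  then obtain S where S: "S \<in> ?F c" "sviridenko v c A' B = v S" by blast
  have "S \<subseteq> A' \<and> sum c S \<le> B"
  proof (cases "S \<in> {U. U \<subseteq> A' \<and> card U \<le> 2 \<and> sum c U \<le> B}")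
    case False
    then obtain U where U: "U \<subseteq> A'" "sum c U \<le> B" "S = sviridenko_extend v c A' B U"
      using S(1) by blast
    have "S \<subseteq> A'"
      unfolding U(3) by (rule sviridenko_extend_invariant(2)[OF fin U(1), of "\<lambda>_. True"]) auto
    then show ?thesis using sviridenko_extend_feasible[OF fin U(1,2)] U(3) by simp
  qed blast
  then show "sviridenko v c A' B \<le> opt v c A' B" using S(2) fin opt_upper by metis
  obtain X where X: "X \<subseteq> A'" "sum c X \<le> B" "opt v c A' B = v X"
    using fin B by (metis opt_attained)
  have finX: "finite X" using X fin finite_subset by blast
  have le: "v S \<le> sviridenko v c A' B" if "S \<in> ?F c" for S
    unfolding sviridenko_def using finF that by (intro Max_ge) auto
  have "(1 - exp (- 1)) * v X \<le> sviridenko v c A' B"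
  proof (cases "card X \<le> 2")
    case True
    have "(1 - exp (- 1)) * v X \<le> v X"
      using valuation_nonneg[OF val X(1)] by (simp add: mult_left_le_one_le)
    also have "\<dots> \<le> sviridenko v c A' B" using True X by (intro le) auto
    finally show ?thesis .
  next
    case False
    then have "3 \<le> card X" by simp
    with val finX X(1) obtain U where U: "U \<subseteq> X" "card U = 3"
      "\<forall>x\<in>X - U. \<forall>S. U \<subseteq> S \<longrightarrow> S \<subseteq> A' \<longrightarrow> 3 * marginal v x S \<le> v U"
      by (rule top_three)
    have UA: "U \<subseteq> A'" using U X by auto
    have "sum c U \<le> B" using sum_cost_mono[OF c' finX U(1) X(1)] X(2) by simp
    then have "v (sviridenko_extend v c A' B U) \<le> sviridenko v c A' B"
      using U UA by (intro le) auto
    moreover have "(1 - exp (- 1)) * v X \<le> v (sviridenko_extend v c A' B U)"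
    proof (rule sviridenko_extend_bound[OF fin val c' U(1) X(1,2)])
      fix x S assume "x \<in> X - U" "U \<subseteq> S" "S \<subseteq> A'"
      then have "3 * marginal v x S \<le> v U" using U(3) by blast
      then have "marginal v x S \<le> 1/3 * v U" by simp
      also have "\<dots> \<le> exp (- 1) * v U"
      proof (rule mult_right_mono[OF _ valuation_nonneg[OF val UA]])
        show "1/3 \<le> exp (- 1 :: real)"
          using exp_one_bounds(2) by (simp add: exp_minus inverse_eq_divide field_simps)
      qed
      finally show "marginal v x S \<le> exp (- 1) * v U" .
    qed
    ultimately show ?thesis by linarith
  qed
  moreover have "1 - exp (- 1) = (exp 1 - 1) / exp (1::real)" by (simp add: exp_minus field_simps)
  ultimately show "opt v c A' B \<le> exp 1 / (exp 1 - 1) * sviridenko v c A' B"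
    using X(3) exp_one_bounds(1) by (simp add: field_simps)
qed

section \<open>The general mechanism, its Sviridenko instance and the numerical guarantee\<close>

theorem theorem4p3:
  shows
    "(\<forall>(r::real) (Orc :: 'a::linorder set \<Rightarrow> 'a valuation \<Rightarrow> 'a value_oracle).
        1 \<le> r \<longrightarrow>
        (\<forall>A v. finite A \<longrightarrow> valuation_on A v \<longrightarrow> approximation_oracle r A v (Orc A v)) \<longrightarrow>
        (\<forall>A v B. market A v B \<longrightarrow>
           truthful A (deterministic_large (Orc A v) (r / (r + 1)) (1 / r) A v B) \<and>
           budget_feasible A B (deterministic_large (Orc A v) (r / (r + 1)) (1 / r) A v B)) \<and>
        large_market_approximation (1 + r)
          (\<lambda>A v B. deterministic_large (Orc A v) (r / (r + 1)) (1 / r) A v B)) \<and>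
     (\<forall>r::real. r = exp 1 / (exp 1 - 1) \<longrightarrow>
        (\<forall>(A :: 'a set) v B. market A v B \<longrightarrow>
           truthful A (deterministic_large (sviridenko v) (r / (r + 1)) (1 / r) A v B) \<and>
           budget_feasible A B (deterministic_large (sviridenko v) (r / (r + 1)) (1 / r) A v B)) \<and>
        large_market_approximation (1 + r)
          (\<lambda>(A :: 'a set) v B. deterministic_large (sviridenko v) (r / (r + 1)) (1 / r) A v B)) \<and>
     \<bar>1 + exp 1 / (exp 1 - 1) - 2.58\<bar> < (0.005 :: real)"
proof -
  have all: "(\<forall>A v B. market A v B \<longrightarrow>
      truthful A (deterministic_large (Orc A v) (r / (r + 1)) (1 / r) A v B) \<and>
      budget_feasible A B (deterministic_large (Orc A v) (r / (r + 1)) (1 / r) A v B)) \<and>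
    large_market_approximation (1 + r)
      (\<lambda>A v B. deterministic_large (Orc A v) (r / (r + 1)) (1 / r) A v B)"
    if r: "1 \<le> r" and orc: "\<forall>A v. finite A \<longrightarrow> valuation_on A v \<longrightarrow> approximation_oracle r A v (Orc A v)"
    for r and Orc :: "'a set \<Rightarrow> 'a valuation \<Rightarrow> 'a value_oracle"
  proof (intro conjI allI impI)
    fix A :: "'a set" and v B assume "market A v B"
    then have A: "finite A" "valuation_on A v" "0 < B" by (auto simp: market_def)
    then have o: "approximation_oracle r A v (Orc A v)" using orc by blast
    show "truthful A (deterministic_large (Orc A v) (r / (r + 1)) (1 / r) A v B)"
      using A r by (intro deterministic_large_truthful[OF _ _ o]) auto
    show "budget_feasible A B (deterministic_large (Orc A v) (r / (r + 1)) (1 / r) A v B)"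
      using A r o by (intro deterministic_large_budget_feasible)
  next
    show "large_market_approximation (1 + r)
        (\<lambda>A v B. deterministic_large (Orc A v) (r / (r + 1)) (1 / r) A v B)"
      using r orc by (intro deterministic_large_approximation) auto
  qed
  have "1 \<le> exp 1 / (exp 1 - 1 :: real)" using exp_one_bounds by simp
  then have sviridenko: "(\<forall>(A :: 'a set) v B. market A v B \<longrightarrow>
      truthful A (deterministic_large (sviridenko v) (r / (r + 1)) (1 / r) A v B) \<and>
      budget_feasible A B (deterministic_large (sviridenko v) (r / (r + 1)) (1 / r) A v B)) \<and>
    large_market_approximation (1 + r)
      (\<lambda>(A :: 'a set) v B. deterministic_large (sviridenko v) (r / (r + 1)) (1 / r) A v B)"
    if "r = exp 1 / (exp 1 - 1)" for r :: real
    using that sviridenko_approximation_oracle by (intro all[of r "\<lambda>_. sviridenko"]) auto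
  \<comment> \<open>The guarantee equals \<open>2 + 1 / (exp 1 - 1)\<close>; the two bounds on
    \<open>exp 1\<close> confine it to between about 2.578 and 2.5826.\<close>
  have bound: "\<bar>1 + exp 1 / (exp 1 - 1) - 2.58\<bar> < (0.005 :: real)"
    using exp_one_bounds unfolding abs_less_iff by (simp add: field_simps)
  show ?thesis
  proof (rule conjI[OF _ conjI[OF _ bound]]; intro allI impI)
  qed (erule (1) all, erule sviridenko)
qed

end
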